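(* Let $G$ be a finite group of squarefree order, presented as $$G=\langle\sigma,\tau : \sigma^e=1,\ \tau^d=1,\ \tau\sigma\tau^{-1}=\sigma^k\rangle,$$ where $d,e,k$ are positive integers, $k$ is coprime to $e$, the multiplicative order of $k$ modulo $e$ is $d$, and $|G|=de$ is squarefree. Put $z=\gcd(e,k-1)$ and $g=e/z$. For each divisor $f$ of $g$ let $d_f$ denote the multiplicative order of $k$ modulo $f$, and let $$\mathfrak{o}(G)=\{(f_1,f_2)\in\mathbb{N}^2 : g=f_1f_2 \text{ and } \gcd(d_{f_1},d_{f_2})\le 2\}.$$ Then the group $T(G)=\mathrm{NHol}(G)/\mathrm{Hol}(G)$ is elementary $2$-abelian of order $\#\mathfrak{o}(G)$.
   Context: $\mathbb{N}$ denotes the positive integers. For a group $G$, $\mathrm{Perm}(G)$ is the symmetric group of the set $G$, and $\rho:G\to\mathrm{Perm}(G)$, $\rho(\sigma)=(x\mapsto x\sigma^{-1})$, is the right regular representation. The holomorph of $G$ is the subgroup $\mathrm{Hol}(G)=\rho(G)\rtimes\mathrm{Aut}(G)$ of $\mathrm{Perm}(G)$. The multiple holomorph is the normalizer $\mathrm{NHol}(G)=\mathrm{Norm}_{\mathrm{Perm}(G)}(\mathrm{Hol}(G))$, and $T(G)=\mathrm{NHol}(G)/\mathrm{Hol}(G)$. "Elementary $2$-abelian" means elementary abelian $2$-group, with the trivial group included. It is a known fact that every finite group of squarefree order admits a presentation of the displayed form. The order of $k$ modulo $1$ is taken to be $1$. *)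

theory Defs
  imports
    "HOL-Algebra.Algebra"
    "HOL-Number_Theory.Number_Theory"
    "HOL-Computational_Algebra.Squarefree"
begin

text \<open>
  Group presentations. A word over the generators \<open>'i\<close> is a list of letters; \<open>(x, True)\<close> stands
  for \<open>x\<close> and \<open>(x, False)\<close> for its inverse. The group presented by a set of relations \<open>l = r\<close>
  is the set of words modulo \<open>word_cong\<close>, the least congruence for concatenation
  that contains the free cancellations and all pairs \<open>(l, r)\<close>.
\<close>

type_synonym 'i word = "('i \<times> bool) list"

inductive word_cong :: "('i word \<times> 'i word) set \<Rightarrow> 'i word \<Rightarrow> 'i word \<Rightarrow> bool"
  for R where
  refl: "word_cong R u u"
| sym: "word_cong R u v \<Longrightarrow> word_cong R v u"
| trans: "word_cong R u v \<Longrightarrow> word_cong R v w \<Longrightarrow> word_cong R u w"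
| cancel: "word_cong R (u @ [(x, b), (x, \<not> b)] @ v) (u @ v)"
| relation: "(l, r) \<in> R \<Longrightarrow> word_cong R (u @ l @ v) (u @ r @ v)"

definition word_eval :: "('a, 'b) monoid_scheme \<Rightarrow> ('i \<Rightarrow> 'a) \<Rightarrow> 'i word \<Rightarrow> 'a" where
  "word_eval G gen w =
     foldr (\<lambda>(x, b) y. (if b then gen x else inv\<^bsub>G\<^esub> (gen x)) \<otimes>\<^bsub>G\<^esub> y) w \<one>\<^bsub>G\<^esub>"

text \<open>
  \<open>G = \<langle>gen | R\<rangle>\<close>: evaluation of words is a bijection from the words modulo \<open>word_cong R\<close> onto \<open>G\<close>.
\<close>

definition presented_by ::
    "('a, 'b) monoid_scheme \<Rightarrow> ('i \<Rightarrow> 'a) \<Rightarrow> ('i word \<times> 'i word) set \<Rightarrow> bool" where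
  "presented_by G gen R \<longleftrightarrow>
     group G \<and> range gen \<subseteq> carrier G \<and>
     range (word_eval G gen) = carrier G \<and>
     (\<forall>u v. word_eval G gen u = word_eval G gen v \<longleftrightarrow> word_cong R u v)"

datatype gen2 = Sigma_gen | Tau_gen

definition metacyclic_relations :: "nat \<Rightarrow> nat \<Rightarrow> nat \<Rightarrow> (gen2 word \<times> gen2 word) set" where
  "metacyclic_relations e d k =
     {(replicate e (Sigma_gen, True), []),
      (replicate d (Tau_gen, True), []),
      ([(Tau_gen, True), (Sigma_gen, True), (Tau_gen, False)], replicate k (Sigma_gen, True))}"

definition right_regular :: "('a, 'b) monoid_scheme \<Rightarrow> 'a \<Rightarrow> 'a \<Rightarrow> 'a" where
  "right_regular G s = (\<lambda>x \<in> carrier G. x \<otimes>\<^bsub>G\<^esub> inv\<^bsub>G\<^esub> s)"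

abbreviation Perm :: "('a, 'b) monoid_scheme \<Rightarrow> ('a \<Rightarrow> 'a) monoid" where
  "Perm G \<equiv> BijGroup (carrier G)"

definition Hol :: "('a, 'b) monoid_scheme \<Rightarrow> ('a \<Rightarrow> 'a) set" where
  "Hol G = right_regular G ` carrier G <#>\<^bsub>Perm G\<^esub> auto G"

definition NHol :: "('a, 'b) monoid_scheme \<Rightarrow> ('a \<Rightarrow> 'a) set" where
  "NHol G = normalizer (Perm G) (Hol G)"

definition T_group :: "('a, 'b) monoid_scheme \<Rightarrow> ('a \<Rightarrow> 'a) set monoid" where
  "T_group G = (Perm G)\<lparr>carrier := NHol G\<rparr> Mod Hol G"

definition elementary_2_abelian :: "('a, 'b) monoid_scheme \<Rightarrow> bool" where
  "elementary_2_abelian H \<longleftrightarrow>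
     comm_group H \<and> (\<forall>x \<in> carrier H. x [^]\<^bsub>H\<^esub> (2::nat) = \<one>\<^bsub>H\<^esub>)"

text \<open>
  \<open>ord f k\<close> is the multiplicative order of \<open>k\<close> modulo \<open>f\<close>; in particular \<open>ord 1 k = 1\<close>.
\<close>

definition factor_pairs :: "nat \<Rightarrow> nat \<Rightarrow> (nat \<times> nat) set" where
  "factor_pairs g k =
     {(f1, f2). f1 > 0 \<and> f2 > 0 \<and> g = f1 * f2 \<and> gcd (ord f1 k) (ord f2 k) \<le> 2}"

end

theory Submission
  imports Defs
begin

text \<open>
  Let \<open>\<pi>\<close> normalize the holomorph. Composing with a translation, let \<open>\<pi>\<close> fix the identity. That \<open>\<pi>\<close>
  conjugates translations into the holomorph means \<open>\<pi> (w y) = \<gamma> (\<pi> y) (\<pi> w) \<cdot> \<pi> y\<close> for automorphisms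
  \<open>\<gamma> x\<close>; so \<open>\<pi>\<close> is an isomorphism from \<open>G\<close> to the group with the operation \<open>x \<circ> y = \<gamma> y x \<cdot> y\<close>. That
  \<open>\<pi>\<close> also normalizes the automorphism group makes \<open>\<gamma>\<close> equivariant under automorphisms, and
  equivariance turns the associativity of \<open>\<circ>\<close> into multiplicativity of \<open>\<gamma>\<close>
  (\<open>NHol_cocycle\<close>). It remains to find the equivariant homomorphisms \<open>\<gamma>\<close> from \<open>G\<close> to its
  automorphism group for which \<open>\<circ>\<close> gives a group isomorphic to \<open>G\<close>.

  Elements are written \<open>\<sigma>^i \<tau>^j\<close>. The centre is generated by \<open>\<sigma>^g\<close>, and \<open>e = g z\<close> with
  \<open>g\<close> and \<open>z\<close> coprime. The automorphisms are the maps
  \<open>\<sigma>^i \<tau>^j \<mapsto> \<sigma>^(u i + m (1 - k^j)) \<tau>^j\<close> (\<open>auto_eq_affine\<close>). In these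
  coordinates the conditions on \<open>\<gamma>\<close> force \<open>\<gamma> \<sigma>\<close> to be conjugation by \<open>\<sigma>^r\<close> and
  \<open>\<gamma> \<tau>\<close> to be \<open>\<sigma> \<mapsto> \<sigma>^a, \<tau> \<mapsto> \<tau>\<close>, where modulo \<open>g\<close> the exponent \<open>r\<close> is idempotent
  and \<open>a = 1 + r (k - 1)\<close> (\<open>normalizer_cocycle_form\<close>). An idempotent modulo the squarefree
  number \<open>g\<close> is a factorization \<open>g = f1 f2\<close>: modulo \<open>f1\<close> the operation \<open>\<circ>\<close> is the product of \<open>G\<close>,
  modulo \<open>f2\<close> it is the opposite product. In the group given by \<open>\<circ>\<close> the image \<open>\<tau>^\<epsilon>\<close> of
  \<open>\<tau>\<close> must act on \<open>\<sigma>\<close> as \<open>\<tau>\<close> does in \<open>G\<close>, so \<open>k^\<epsilon>\<close> is \<open>k\<close> modulo \<open>f1\<close> and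
  \<open>k^(-1)\<close> modulo \<open>f2\<close>. Such an \<open>\<epsilon>\<close> is \<open>1\<close> modulo the order of \<open>k\<close> modulo \<open>f1\<close> and \<open>- 1\<close>
  modulo its order modulo \<open>f2\<close>; it exists iff the gcd of these orders divides \<open>2\<close>.

  Conversely, with \<open>\<kappa>\<close> equal to \<open>1\<close> modulo \<open>f1 z\<close> and to \<open>k^(-1)\<close> modulo \<open>f2\<close>, the
  map \<open>\<sigma>^i \<tau>^j \<mapsto> \<sigma>^(\<kappa>^j i) \<tau>^(\<epsilon> j)\<close>, called a twist below, is an involution that
  normalizes the holomorph (\<open>twist_in_NHol\<close>). Up to automorphisms it is the only \<open>\<pi>\<close> belonging to
  \<open>f1\<close> and \<open>f2\<close> (\<open>NHol_fix_one_eq_affine_twist\<close>), and its coset determines \<open>\<kappa>\<close>, hence the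
  factorization. So the cosets of the holomorph are represented by involutions, one for each element
  of \<open>factor_pairs g k\<close>, and a group of exponent two is elementary abelian.
\<close>

section \<open>Normalizers and quotients represented by involutions\<close>

lemma (in group) normalizer_iff:
  assumes H: "subgroup H G"
  shows "x \<in> normalizer G H \<longleftrightarrow>
    x \<in> carrier G \<and> (\<forall>h\<in>H. x \<otimes> h \<otimes> inv x \<in> H) \<and> (\<forall>h\<in>H. inv x \<otimes> h \<otimes> x \<in> H)"
proof -
  have HG: "H \<subseteq> carrier G" using H by (rule subgroup.subset)
  have coset: "x <# H #> inv x = (\<lambda>h. x \<otimes> h \<otimes> inv x) ` H"
    unfolding l_coset_def r_coset_def by auto
  have "x <# H #> inv x = H \<longleftrightarrow>
      (\<forall>h\<in>H. x \<otimes> h \<otimes> inv x \<in> H) \<and> (\<forall>h\<in>H. inv x \<otimes> h \<otimes> x \<in> H)"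
    if x: "x \<in> carrier G"
  proof (intro iffI conjI ballI)
    fix h assume eq: "x <# H #> inv x = H" and h: "h \<in> H"
    show "x \<otimes> h \<otimes> inv x \<in> H" using eq h unfolding coset by blast
    from eq h obtain h' where h': "h' \<in> H" "h = x \<otimes> h' \<otimes> inv x" unfolding coset by blast
    then have "inv x \<otimes> h \<otimes> x = h'" using x HG by (auto simp: m_assoc subset_iff) (simp add: m_assoc[symmetric])
    then show "inv x \<otimes> h \<otimes> x \<in> H" using h' by simp
  next
    assume *: "(\<forall>h\<in>H. x \<otimes> h \<otimes> inv x \<in> H) \<and> (\<forall>h\<in>H. inv x \<otimes> h \<otimes> x \<in> H)"
    have "h \<in> (\<lambda>h. x \<otimes> h \<otimes> inv x) ` H" if h: "h \<in> H" for h
    proof (rule image_eqI)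
      show "h = x \<otimes> (inv x \<otimes> h \<otimes> x) \<otimes> inv x"
        using x h HG by (simp add: m_assoc subset_iff) (metis h inv_closed inv_solve_left l_inv m_assoc m_closed r_one subgroup.mem_carrier H x)
    qed (use * h in blast)
    then show "x <# H #> inv x = H" unfolding coset using * by blast
  qed
  then show ?thesis
    using HG unfolding normalizer_def stabilizer_def by auto
qed

text \<open>
  If involutions represent all cosets, every element of the quotient has square one, and commutativity
  follows.
\<close>
lemma (in group) elementary_2_abelian_Mod:
  assumes N: "N \<lhd> G" and F: "finite F"
    and rep: "\<And>f. f \<in> F \<Longrightarrow> rep f \<in> carrier G"
    and invol: "\<And>f. f \<in> F \<Longrightarrow> rep f \<otimes> rep f = \<one>"
    and cover: "\<And>x. x \<in> carrier G \<Longrightarrow> \<exists>f\<in>F. x \<in> N #> rep f"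
    and distinct: "\<And>f f'. f \<in> F \<Longrightarrow> f' \<in> F \<Longrightarrow> rep f' \<in> N #> rep f \<Longrightarrow> f' = f"
  shows "elementary_2_abelian (G Mod N) \<and> order (G Mod N) = card F"
proof -
  interpret N: normal N G by (rule N)
  interpret Q: group "G Mod N" by (rule N.factorgroup_is_group)
  have carrier: "carrier (G Mod N) = (\<lambda>f. N #> rep f) ` F"
  proof (intro subset_antisym subsetI)
    fix C assume "C \<in> carrier (G Mod N)"
    then obtain x where x: "x \<in> carrier G" "C = N #> x"
      unfolding FactGroup_def RCOSETS_def by auto
    then obtain f where f: "f \<in> F" "x \<in> N #> rep f" using cover by blast
    then have "C = N #> rep f" using x rep
      by (metis N.subgroup_axioms repr_independence)
    then show "C \<in> (\<lambda>f. N #> rep f) ` F" using f by blast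
  qed (use rep in \<open>auto simp: FactGroup_def RCOSETS_def\<close>)
  have "inj_on (\<lambda>f. N #> rep f) F"
  proof (rule inj_onI)
    fix f f' assume "f \<in> F" "f' \<in> F" "N #> rep f = N #> rep f'"
    then have "rep f' \<in> N #> rep f" using rep rcos_self[OF _ N.subgroup_axioms] \<open>f' \<in> F\<close> by simp
    then show "f = f'" using distinct[OF \<open>f \<in> F\<close> \<open>f' \<in> F\<close>] by simp
  qed
  then have card: "order (G Mod N) = card F"
    unfolding order_def carrier by (rule card_image)
  have square: "C \<otimes>\<^bsub>G Mod N\<^esub> C = \<one>\<^bsub>G Mod N\<^esub>" if "C \<in> carrier (G Mod N)" for C
  proof -
    obtain f where f: "f \<in> F" "C = N #> rep f" using \<open>C \<in> _\<close> unfolding carrier by blast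
    have "C <#> C = N #> (rep f \<otimes> rep f)" unfolding f using rep f N.rcos_sum by simp
    also have "\<dots> = N" using f invol N.subset by simp
    finally show ?thesis by (simp add: FactGroup_def)
  qed
  \<comment> \<open>In a group of exponent two, \<open>y x = inv (x y) = x y\<close>.\<close>
  have "C \<otimes>\<^bsub>G Mod N\<^esub> D = D \<otimes>\<^bsub>G Mod N\<^esub> C"
    if C: "C \<in> carrier (G Mod N)" and D: "D \<in> carrier (G Mod N)" for C D
  proof -
    have self: "inv\<^bsub>G Mod N\<^esub> E = E" if "E \<in> carrier (G Mod N)" for E
      using Q.inv_equality[OF square] that by blast
    have "inv\<^bsub>G Mod N\<^esub> (C \<otimes>\<^bsub>G Mod N\<^esub> D) = D \<otimes>\<^bsub>G Mod N\<^esub> C"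
      using C D Q.inv_mult_group self by simp
    then show ?thesis using self C D Q.m_closed by metis
  qed
  then have "comm_group (G Mod N)"
    by (intro Q.group_comm_groupI)
  then show ?thesis unfolding elementary_2_abelian_def
    using card square Q.l_one by (simp add: numeral_2_eq_2 del: one_FactGroup mult_FactGroup)
qed

section \<open>The holomorph and its normalizer\<close>
context group
begin

lemma auto_mult: "\<beta> \<in> auto G \<Longrightarrow> x \<in> carrier G \<Longrightarrow> y \<in> carrier G \<Longrightarrow> \<beta> (x \<otimes> y) = \<beta> x \<otimes> \<beta> y"
  by (simp add: auto_def hom_mult)

lemma auto_closed: "\<beta> \<in> auto G \<Longrightarrow> x \<in> carrier G \<Longrightarrow> \<beta> x \<in> carrier G"
  by (auto simp: auto_def hom_def)

lemma auto_one: "\<beta> \<in> auto G \<Longrightarrow> \<beta> \<one> = \<one>"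
  by (simp add: auto_def hom_one)

lemma auto_group_hom: "\<beta> \<in> auto G \<Longrightarrow> group_hom G G \<beta>"
  by (auto simp: auto_def group_hom_def group_hom_axioms_def intro: group_axioms)

lemma auto_bij: "\<beta> \<in> auto G \<Longrightarrow> bij_betw \<beta> (carrier G) (carrier G)"
  by (simp add: auto_def Bij_def)

lemma auto_surj: "\<beta> \<in> auto G \<Longrightarrow> y \<in> carrier G \<Longrightarrow> \<exists>x\<in>carrier G. \<beta> x = y"
  by (metis bij_betw_imp_surj_on[OF auto_bij] imageE)

lemma translation_Bij:
  assumes "s \<in> carrier G" shows "(\<lambda>x\<in>carrier G. x \<otimes> s) \<in> Bij (carrier G)"
proof -
  have "y \<in> (\<lambda>x. x \<otimes> s) ` carrier G" if "y \<in> carrier G" for y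
    using that assms by (intro image_eqI[of _ _ "y \<otimes> inv s"]) (auto simp: m_assoc)
  then show ?thesis using assms unfolding Bij_def bij_betw_def inj_on_def by auto
qed

text \<open>
  The form of the elements of the holomorph used throughout: an automorphism followed by a right
  translation. The automorphism and the translation are unique, since the value at \<open>\<one>\<close> is \<open>s\<close>.
\<close>
lemma Hol_eq:
  "Hol G = {\<lambda>x\<in>carrier G. \<beta> x \<otimes> s | \<beta> s. \<beta> \<in> auto G \<and> s \<in> carrier G}"
proof -
  have *: "right_regular G s \<otimes>\<^bsub>Perm G\<^esub> \<beta> = (\<lambda>x\<in>carrier G. \<beta> x \<otimes> inv s)"
    if "s \<in> carrier G" "\<beta> \<in> auto G" for s \<beta>
  proof -
    have "right_regular G s \<in> Bij (carrier G)" "\<beta> \<in> Bij (carrier G)"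
      using translation_Bij[of "inv s"] that unfolding right_regular_def auto_def by auto
    then show ?thesis
      using auto_closed[OF that(2)]
      by (auto simp: BijGroup_def compose_def right_regular_def fun_eq_iff restrict_def)
  qed
  show ?thesis
  proof (intro subset_antisym subsetI)
    fix h assume "h \<in> Hol G"
    then obtain s \<beta> where "s \<in> carrier G" "\<beta> \<in> auto G" "h = right_regular G s \<otimes>\<^bsub>Perm G\<^esub> \<beta>"
      unfolding Hol_def set_mult_def by blast
    then show "h \<in> {\<lambda>x\<in>carrier G. \<beta> x \<otimes> s | \<beta> s. \<beta> \<in> auto G \<and> s \<in> carrier G}"
      using * inv_closed by blast
  next
    fix h assume "h \<in> {\<lambda>x\<in>carrier G. \<beta> x \<otimes> s | \<beta> s. \<beta> \<in> auto G \<and> s \<in> carrier G}"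
    then obtain s \<beta> where h: "s \<in> carrier G" "\<beta> \<in> auto G" "h = (\<lambda>x\<in>carrier G. \<beta> x \<otimes> s)" by blast
    then have "h = right_regular G (inv s) \<otimes>\<^bsub>Perm G\<^esub> \<beta>" using *[of "inv s" \<beta>] by simp
    then show "h \<in> Hol G" unfolding Hol_def set_mult_def using h inv_closed by blast
  qed
qed

lemma HolI:
  assumes "\<beta> \<in> auto G" "s \<in> carrier G" "h \<in> extensional (carrier G)"
    and "\<And>x. x \<in> carrier G \<Longrightarrow> h x = \<beta> x \<otimes> s"
  shows "h \<in> Hol G"
proof -
  have "h = (\<lambda>x\<in>carrier G. \<beta> x \<otimes> s)" using assms(3,4) by (auto simp: fun_eq_iff extensional_def)
  then show ?thesis unfolding Hol_eq using assms by blast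
qed

lemma HolE:
  assumes "h \<in> Hol G"
  obtains \<beta> s where "\<beta> \<in> auto G" "s \<in> carrier G" "\<And>x. x \<in> carrier G \<Longrightarrow> h x = \<beta> x \<otimes> s"
proof -
  obtain \<beta> s where "\<beta> \<in> auto G" "s \<in> carrier G" "h = (\<lambda>x\<in>carrier G. \<beta> x \<otimes> s)"
    using assms unfolding Hol_eq by blast
  with that show thesis by simp
qed

lemma auto_subset_Hol: "\<beta> \<in> auto G \<Longrightarrow> \<beta> \<in> Hol G"
  by (rule HolI[of \<beta> \<one>]) (auto simp: auto_closed auto_def Bij_def)

lemma translation_in_Hol: "s \<in> carrier G \<Longrightarrow> (\<lambda>x\<in>carrier G. x \<otimes> s) \<in> Hol G"
  by (rule HolI[OF id_in_auto]) auto

lemma Hol_subset_Bij: "Hol G \<subseteq> Bij (carrier G)"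
proof
  fix h assume "h \<in> Hol G"
  then obtain \<beta> s where *: "\<beta> \<in> auto G" "s \<in> carrier G" "h = (\<lambda>x\<in>carrier G. \<beta> x \<otimes> s)"
    unfolding Hol_eq by blast
  then have "h = compose (carrier G) (\<lambda>x\<in>carrier G. x \<otimes> s) \<beta>"
    by (auto simp: compose_def fun_eq_iff auto_closed)
  then show "h \<in> Bij (carrier G)"
    using compose_Bij[OF translation_Bij[OF *(2)], of \<beta>] *(1) by (simp add: auto_def)
qed

lemma Hol_fix_one:
  assumes h: "h \<in> Hol G" and "h \<one> = \<one>" shows "h \<in> auto G"
proof -
  obtain \<beta> s where b: "\<beta> \<in> auto G" "s \<in> carrier G" "\<And>x. x \<in> carrier G \<Longrightarrow> h x = \<beta> x \<otimes> s"
    using HolE[OF h] by blast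
  then have "s = \<one>" using assms(2) auto_one[of \<beta>] by simp
  then have "h x = \<beta> x" for x
    using b h Hol_subset_Bij auto_closed by (cases "x \<in> carrier G")
      (auto simp: auto_def Bij_def extensional_def)
  then have "h = \<beta>" by blast
  then show ?thesis using b by simp
qed

lemma subgroup_Hol: "subgroup (Hol G) (Perm G)"
proof -
  interpret P: group "Perm G" by (rule group_BijGroup)
  interpret A: subgroup "auto G" "Perm G" by (rule subgroup_auto)
  have mult: "f \<otimes>\<^bsub>Perm G\<^esub> h = compose (carrier G) f h" if "f \<in> Hol G" "h \<in> Hol G" for f h
    using that Hol_subset_Bij by (auto simp: BijGroup_def)
  have auto_mult_eq: "compose (carrier G) f h \<in> auto G" if "f \<in> auto G" "h \<in> auto G" for f h
    using A.m_closed[OF that] that by (auto simp: BijGroup_def auto_def)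
  have closed: "f \<otimes>\<^bsub>Perm G\<^esub> h \<in> Hol G" if f: "f \<in> Hol G" and h: "h \<in> Hol G" for f h
  proof -
    obtain \<beta> s where b: "\<beta> \<in> auto G" "s \<in> carrier G" "\<And>x. x \<in> carrier G \<Longrightarrow> f x = \<beta> x \<otimes> s"
      using HolE[OF f] by blast
    obtain \<alpha> t where a: "\<alpha> \<in> auto G" "t \<in> carrier G" "\<And>x. x \<in> carrier G \<Longrightarrow> h x = \<alpha> x \<otimes> t"
      using HolE[OF h] by blast
    show ?thesis unfolding mult[OF f h]
      using a b auto_closed[OF a(1)] auto_closed[OF b(1)]
      by (intro HolI[OF auto_mult_eq[OF b(1) a(1)], of "\<beta> t \<otimes> s"])
        (auto simp: compose_def auto_mult m_assoc)
  qed
  have inverse: "inv\<^bsub>Perm G\<^esub> f \<in> Hol G" if f: "f \<in> Hol G" for f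
  proof -
    obtain \<beta> s where b: "\<beta> \<in> auto G" "s \<in> carrier G" "\<And>x. x \<in> carrier G \<Longrightarrow> f x = \<beta> x \<otimes> s"
      using HolE[OF f] by blast
    define \<alpha> where "\<alpha> = inv\<^bsub>Perm G\<^esub> \<beta>"
    have \<alpha>: "\<alpha> \<in> auto G" unfolding \<alpha>_def using b by (intro A.m_inv_closed)
    have "compose (carrier G) \<alpha> \<beta> = (\<lambda>x\<in>carrier G. x)"
      using P.l_inv[of \<beta>] b \<alpha> unfolding \<alpha>_def by (auto simp: BijGroup_def auto_def)
    then have \<alpha>\<beta>: "\<alpha> (\<beta> x) = x" if "x \<in> carrier G" for x
      using that by (metis compose_eq restrict_apply')
    define h where "h = (\<lambda>x\<in>carrier G. \<alpha> x \<otimes> \<alpha> (inv s))"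
    have h: "h \<in> Hol G"
      by (rule HolI[OF \<alpha>, of "\<alpha> (inv s)"]) (use b auto_closed[OF \<alpha>] in \<open>auto simp: h_def\<close>)
    have "h \<otimes>\<^bsub>Perm G\<^esub> f = \<one>\<^bsub>Perm G\<^esub>"
      unfolding mult[OF h f] using b \<alpha>
      by (auto simp: BijGroup_def compose_def h_def fun_eq_iff restrict_def auto_closed
          auto_mult[symmetric] m_assoc \<alpha>\<beta>)
    then have "inv\<^bsub>Perm G\<^esub> f = h"
      using f h Hol_subset_Bij by (intro P.inv_equality) (auto simp: BijGroup_def)
    then show ?thesis using h by simp
  qed
  show ?thesis
    using closed inverse Hol_subset_Bij auto_subset_Hol id_in_auto
    by (intro P.subgroupI) (auto simp: BijGroup_def)
qed

lemma NHol_subset_Bij: "NHol G \<subseteq> Bij (carrier G)"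
  using group.normalizer_iff[OF group_BijGroup subgroup_Hol]
  by (auto simp: NHol_def BijGroup_def)

text \<open>
  Together the two parts say that \<open>\<pi>\<close> conjugates the holomorph onto itself, not only into itself.
\<close>
lemma NHol_conj:
  assumes \<pi>: "\<pi> \<in> NHol G" and h: "h \<in> Hol G"
  shows "\<exists>h'\<in>Hol G. \<forall>x\<in>carrier G. \<pi> (h x) = h' (\<pi> x)"
    and "\<exists>h'\<in>Hol G. \<forall>x\<in>carrier G. \<pi> (h' x) = h (\<pi> x)"
proof -
  interpret P: group "Perm G" by (rule group_BijGroup)
  have P: "\<pi> \<in> carrier (Perm G)" "h \<in> carrier (Perm G)"
    using \<pi> h NHol_subset_Bij Hol_subset_Bij by (auto simp: BijGroup_def)
  have pt: "f (g x) = f' (g' x)"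
    if "f \<otimes>\<^bsub>Perm G\<^esub> g = f' \<otimes>\<^bsub>Perm G\<^esub> g'" "x \<in> carrier G" "f \<in> carrier (Perm G)" "g \<in> carrier (Perm G)"
       "f' \<in> carrier (Perm G)" "g' \<in> carrier (Perm G)" for f g f' g' x
    using that fun_cong[OF that(1), of x] by (auto simp: BijGroup_def compose_def)
  define h1 where "h1 = \<pi> \<otimes>\<^bsub>Perm G\<^esub> h \<otimes>\<^bsub>Perm G\<^esub> inv\<^bsub>Perm G\<^esub> \<pi>"
  define h2 where "h2 = inv\<^bsub>Perm G\<^esub> \<pi> \<otimes>\<^bsub>Perm G\<^esub> h \<otimes>\<^bsub>Perm G\<^esub> \<pi>"
  have mem: "h1 \<in> Hol G" "h2 \<in> Hol G"
    using \<pi> h P.normalizer_iff[OF subgroup_Hol] unfolding NHol_def h1_def h2_def by auto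
  then have memP: "h1 \<in> carrier (Perm G)" "h2 \<in> carrier (Perm G)"
    using Hol_subset_Bij by (auto simp: BijGroup_def)
  have "\<pi> \<otimes>\<^bsub>Perm G\<^esub> h = h1 \<otimes>\<^bsub>Perm G\<^esub> \<pi>" unfolding h1_def using P by (simp add: P.m_assoc)
  then show "\<exists>h'\<in>Hol G. \<forall>x\<in>carrier G. \<pi> (h x) = h' (\<pi> x)" using pt mem memP P by blast
  have "\<pi> \<otimes>\<^bsub>Perm G\<^esub> h2 = h \<otimes>\<^bsub>Perm G\<^esub> \<pi>" unfolding h2_def using P
    by (metis P.inv_closed P.inv_solve_left P.m_assoc P.m_closed)
  then show "\<exists>h'\<in>Hol G. \<forall>x\<in>carrier G. \<pi> (h' x) = h (\<pi> x)" using pt mem memP P by blast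
qed

text \<open>
  For an involution both directions of normalization are the same condition.
\<close>
lemma involution_in_NHol:
  assumes \<pi>: "\<pi> \<in> Bij (carrier G)" and invol: "\<And>x. x \<in> carrier G \<Longrightarrow> \<pi> (\<pi> x) = x"
    and conj: "\<And>h. h \<in> Hol G \<Longrightarrow> compose (carrier G) \<pi> (compose (carrier G) h \<pi>) \<in> Hol G"
  shows "\<pi> \<in> NHol G"
proof -
  interpret P: group "Perm G" by (rule group_BijGroup)
  have P: "\<pi> \<in> carrier (Perm G)" using \<pi> by (simp add: BijGroup_def)
  have "\<pi> \<otimes>\<^bsub>Perm G\<^esub> \<pi> = \<one>\<^bsub>Perm G\<^esub>"
    using \<pi> invol by (auto simp: BijGroup_def compose_def fun_eq_iff)
  then have inv: "inv\<^bsub>Perm G\<^esub> \<pi> = \<pi>" using P by (intro P.inv_equality)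
  have "\<pi> \<otimes>\<^bsub>Perm G\<^esub> h \<otimes>\<^bsub>Perm G\<^esub> \<pi> \<in> Hol G" if h: "h \<in> Hol G" for h
  proof -
    have "h \<in> carrier (Perm G)" using h Hol_subset_Bij by (auto simp: BijGroup_def)
    then have "\<pi> \<otimes>\<^bsub>Perm G\<^esub> h \<otimes>\<^bsub>Perm G\<^esub> \<pi> = compose (carrier G) \<pi> (compose (carrier G) h \<pi>)"
      using P by (simp add: P.m_assoc) (simp add: BijGroup_def compose_Bij)
    then show ?thesis using conj[OF h] by simp
  qed
  then show ?thesis
    unfolding NHol_def P.normalizer_iff[OF subgroup_Hol] inv using P by blast
qed

text \<open>
  The action part of the group structure \<open>x \<circ> y = \<gamma> y x \<otimes> y\<close> carried over from \<open>G\<close> along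
  \<open>\<pi>\<close>: the map \<open>w \<mapsto> \<gamma> x w \<otimes> x\<close> is the conjugate under \<open>\<pi>\<close> of the right translation
  that sends \<open>\<one>\<close> to the preimage of \<open>x\<close>.
\<close>
definition normalizer_cocycle :: "('a \<Rightarrow> 'a) \<Rightarrow> ('a \<Rightarrow> 'a \<Rightarrow> 'a) \<Rightarrow> bool" where
  "normalizer_cocycle \<pi> \<gamma> \<longleftrightarrow>
     (\<forall>x\<in>carrier G. \<gamma> x \<in> auto G) \<and>
     (\<forall>w\<in>carrier G. \<forall>y\<in>carrier G. \<pi> (w \<otimes> y) = \<gamma> (\<pi> y) (\<pi> w) \<otimes> \<pi> y) \<and>
     (\<forall>\<beta>\<in>auto G. \<forall>x\<in>carrier G. \<forall>v\<in>carrier G. \<gamma> (\<beta> x) (\<beta> v) = \<beta> (\<gamma> x v)) \<and>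
     (\<forall>x\<in>carrier G. \<forall>y\<in>carrier G. \<forall>v\<in>carrier G. \<gamma> (x \<otimes> y) v = \<gamma> x (\<gamma> y v))"

lemma normalizer_cocycleD:
  assumes "normalizer_cocycle \<pi> \<gamma>"
  shows "x \<in> carrier G \<Longrightarrow> \<gamma> x \<in> auto G"
    and "w \<in> carrier G \<Longrightarrow> y \<in> carrier G \<Longrightarrow> \<pi> (w \<otimes> y) = \<gamma> (\<pi> y) (\<pi> w) \<otimes> \<pi> y"
    and "\<beta> \<in> auto G \<Longrightarrow> x \<in> carrier G \<Longrightarrow> v \<in> carrier G \<Longrightarrow> \<gamma> (\<beta> x) (\<beta> v) = \<beta> (\<gamma> x v)"
    and "x \<in> carrier G \<Longrightarrow> y \<in> carrier G \<Longrightarrow> v \<in> carrier G \<Longrightarrow> \<gamma> (x \<otimes> y) v = \<gamma> x (\<gamma> y v)"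
  using assms unfolding normalizer_cocycle_def by blast+

text \<open>
  Comparing the two ways of bracketing \<open>\<pi> (w a b)\<close> gives \<open>\<gamma> (\<gamma> y u \<otimes> y) = \<gamma> y \<circ> \<gamma> u\<close>.
  Equivariance under the automorphism \<open>\<gamma> y\<close> moves it to the other side, and with \<open>x = \<gamma> y u\<close>
  this becomes multiplicativity.
\<close>
lemma NHol_cocycle:
  assumes \<pi>: "\<pi> \<in> NHol G" and one: "\<pi> \<one> = \<one>"
  shows "\<exists>\<gamma>. normalizer_cocycle \<pi> \<gamma>"
proof -
  have bij: "bij_betw \<pi> (carrier G) (carrier G)"
    using subsetD[OF NHol_subset_Bij \<pi>] by (simp add: Bij_def)
  have cl: "\<pi> x \<in> carrier G" if "x \<in> carrier G" for x
    using bij_betwE[OF bij] that by blast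
  have surj: "\<exists>y\<in>carrier G. \<pi> y = x" if "x \<in> carrier G" for x
    using bij_betw_imp_surj_on[OF bij] that by (metis imageE)
  have inj: "y = y'" if "\<pi> y = \<pi> y'" "y \<in> carrier G" "y' \<in> carrier G" for y y'
    using bij_betw_imp_inj_on[OF bij] that by (metis inj_onD)
  have "\<exists>\<beta>. \<beta> \<in> auto G \<and> (\<forall>w\<in>carrier G. \<forall>y\<in>carrier G. \<pi> y = x \<longrightarrow> \<pi> (w \<otimes> y) = \<beta> (\<pi> w) \<otimes> x)"
    if x: "x \<in> carrier G" for x
  proof -
    obtain y where y: "y \<in> carrier G" "\<pi> y = x" using surj x by blast
    obtain h where h: "h \<in> Hol G" "\<forall>w\<in>carrier G. \<pi> (w \<otimes> y) = h (\<pi> w)"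
      using NHol_conj(1)[OF \<pi> translation_in_Hol[OF y(1)]] by auto
    obtain \<beta> s where b: "\<beta> \<in> auto G" "s \<in> carrier G" "\<And>x. x \<in> carrier G \<Longrightarrow> h x = \<beta> x \<otimes> s"
      using HolE[OF h(1)] by blast
    have "s = x" using h(2)[rule_format, of \<one>] b y one auto_one[OF b(1)] by simp
    then have "\<pi> (w \<otimes> y) = \<beta> (\<pi> w) \<otimes> x" if "w \<in> carrier G" for w using that h b cl by simp
    then show ?thesis using b(1) y inj by blast
  qed
  then obtain \<gamma> where \<gamma>: "\<And>x. x \<in> carrier G \<Longrightarrow> \<gamma> x \<in> auto G"
    and \<gamma>': "\<And>x w y. x \<in> carrier G \<Longrightarrow> w \<in> carrier G \<Longrightarrow> y \<in> carrier G \<Longrightarrow> \<pi> y = x \<Longrightarrow>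
        \<pi> (w \<otimes> y) = \<gamma> x (\<pi> w) \<otimes> x"
    by metis
  have cocycle: "\<pi> (w \<otimes> y) = \<gamma> (\<pi> y) (\<pi> w) \<otimes> \<pi> y" if "w \<in> carrier G" "y \<in> carrier G" for w y
    using \<gamma>'[OF cl[OF that(2)] that HOL.refl] .
  have \<gamma>cl: "\<gamma> x v \<in> carrier G" if "x \<in> carrier G" "v \<in> carrier G" for x v
    using \<gamma> auto_closed that by blast
  have equivariant: "\<gamma> (\<beta> x) (\<beta> v) = \<beta> (\<gamma> x v)"
    if \<beta>: "\<beta> \<in> auto G" and x: "x \<in> carrier G" and v: "v \<in> carrier G" for \<beta> x v
  proof -
    obtain y where y: "y \<in> carrier G" "\<pi> y = x" using surj x by blast
    obtain w where w: "w \<in> carrier G" "\<pi> w = v" using surj v by blast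
    \<comment> \<open>Every automorphism is the conjugate under \<open>\<pi>\<close> of another automorphism \<open>h\<close>.\<close>
    obtain h where h: "h \<in> Hol G" "\<And>x. x \<in> carrier G \<Longrightarrow> \<pi> (h x) = \<beta> (\<pi> x)"
      using NHol_conj(2)[OF \<pi> auto_subset_Hol[OF \<beta>]] by auto
    have "h \<one> \<in> carrier G" using h Hol_subset_Bij Bij_imp_funcset by blast
    then have "h \<one> = \<one>" using h(2)[of \<one>] one auto_one[OF \<beta>] inj by simp
    then have hA: "h \<in> auto G" using Hol_fix_one h by blast
    have "\<gamma> (\<beta> x) (\<beta> v) \<otimes> \<beta> x = \<pi> (h w \<otimes> h y)"
      using cocycle[of "h w" "h y"] h w y auto_closed[OF hA] by simp
    also have "\<dots> = \<beta> (\<pi> (w \<otimes> y))" using h(2)[of "w \<otimes> y"] auto_mult[OF hA w(1) y(1)] w y by simp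
    also have "\<dots> = \<beta> (\<gamma> x v) \<otimes> \<beta> x"
      using cocycle[of w y] w y x v \<gamma>cl auto_mult[OF \<beta>] by simp
    finally show ?thesis using \<gamma>cl auto_closed[OF \<beta>] x v by simp
  qed
  have "\<gamma> (x \<otimes> y) v = \<gamma> x (\<gamma> y v)"
    if xG: "x \<in> carrier G" and yG: "y \<in> carrier G" and vG: "v \<in> carrier G" for x y v
  proof -
    obtain u where u: "u \<in> carrier G" "\<gamma> y u = x" using auto_surj[OF \<gamma>[OF yG] xG] by blast
    obtain b where b: "b \<in> carrier G" "\<pi> b = y" using surj yG by blast
    obtain a where a: "a \<in> carrier G" "\<pi> a = u" using surj u by blast
    obtain w where w: "w \<in> carrier G" "\<pi> w = v" using surj vG by blast
    have ab: "\<pi> (a \<otimes> b) = x \<otimes> y" using cocycle[of a b] a b u by simp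
    have "\<gamma> (x \<otimes> y) v \<otimes> (x \<otimes> y) = \<pi> (w \<otimes> (a \<otimes> b))"
      using cocycle[of w "a \<otimes> b"] a b w ab by simp
    also have "\<dots> = \<pi> ((w \<otimes> a) \<otimes> b)" using a b w by (simp add: m_assoc)
    also have "\<dots> = \<gamma> y (\<gamma> u v \<otimes> u) \<otimes> y"
      using cocycle[of "w \<otimes> a" b] cocycle[of w a] a b w by simp
    also have "\<dots> = \<gamma> y (\<gamma> u v) \<otimes> (x \<otimes> y)"
      using auto_mult[OF \<gamma>[OF yG]] \<gamma>cl u vG yG xG by (simp add: m_assoc)
    also have "\<gamma> y (\<gamma> u v) = \<gamma> x (\<gamma> y v)"
      using equivariant[OF \<gamma>[OF yG] u(1) vG] u by simp
    finally show ?thesis using \<gamma>cl xG yG vG by simp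
  qed
  with \<gamma> cocycle equivariant have "normalizer_cocycle \<pi> \<gamma>"
    unfolding normalizer_cocycle_def by (intro conjI ballI)
  then show ?thesis by blast
qed

end

section \<open>Squarefree numbers and congruences\<close>
lemma squarefree_mult_imp_coprime:
  fixes a b :: nat
  assumes "squarefree (a * b)" shows "coprime a b"
proof (rule coprimeI)
  fix c assume "c dvd a" "c dvd b"
  then have "c ^ 2 dvd a * b" by (simp add: power2_eq_square mult_dvd_mono)
  then show "is_unit c" using assms by (rule squarefreeD[rotated])
qed

lemma squarefree_dvd_square:
  fixes n x :: nat
  assumes "squarefree n" and "n dvd x * x" shows "n dvd x"
proof -
  obtain b c where n: "n = b * c" "b dvd x" "c dvd x" using division_decomp[OF assms(2)] by blast
  then have "coprime b c" using assms(1) squarefree_mult_imp_coprime by blast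
  then show ?thesis using n by (simp add: divides_mult)
qed
lemma cong_power_exponent:
  fixes x :: int and i j m :: nat
  assumes "[x ^ m = 1] (mod n)" and "[i = j] (mod m)"
  shows "[x ^ i = x ^ j] (mod n)"
proof -
  have "[x ^ i = x ^ (i mod m)] (mod n)" for i
  proof -
    have "x ^ i = (x ^ m) ^ (i div m) * x ^ (i mod m)"
      by (metis mult_div_mod_eq power_add power_mult)
    also have "[\<dots> = 1 ^ (i div m) * x ^ (i mod m)] (mod n)"
      by (intro cong_mult cong_pow assms(1)) auto
    finally show ?thesis by simp
  qed
  then show ?thesis using assms(2) by (metis cong_def)
qed

section \<open>Metacyclic groups in coordinates\<close>

text \<open>
  The consequences of the presentation that the proof uses. Together with the order of the group, the
  relations determine it. That the order of \<open>k\<close> is the whole of \<open>d\<close> says that \<open>\<tau>\<close> acts faithfully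
  on the subgroup generated by \<open>\<sigma>\<close>.
\<close>
locale faithful_metacyclic = group G for G (structure) +
  fixes \<sigma> \<tau> :: 'a and d e k z g :: nat
  assumes sigma [simp]: "\<sigma> \<in> carrier G" and tau [simp]: "\<tau> \<in> carrier G"
    and generated: "carrier G \<subseteq> generate G {\<sigma>, \<tau>}"
    and d_pos: "d > 0" and e_pos: "e > 0" and k_pos: "k > 0"
    and sigma_pow: "\<sigma> [^] e = \<one>" and tau_pow: "\<tau> [^] d = \<one>"
    and conj: "\<tau> \<otimes> \<sigma> \<otimes> inv \<tau> = \<sigma> [^] k"
    and coprime_ke: "coprime k e" and ord_k: "Pocklington.ord e k = d"
    and order_eq: "order G = d * e" and sqfree: "squarefree (d * e)"
    and z_def: "z = gcd e (k - 1)" and g_def: "g = e div z"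
begin

abbreviation K :: int where "K \<equiv> int k"

lemma e_eq: "e = g * z" using z_def g_def by simp

lemma g_pos: "g > 0" using e_pos e_eq by (auto intro: Nat.gr0I)

lemma coprime_de: "coprime d e" using sqfree by (rule squarefree_mult_imp_coprime)

lemma sqfree_e: "squarefree e" using sqfree by (rule squarefree_multD)

lemma sqfree_g: "squarefree g" using sqfree_e unfolding e_eq by (rule squarefree_multD)

lemma coprime_gz: "coprime g z" using sqfree_e unfolding e_eq by (rule squarefree_mult_imp_coprime)

lemma coprime_dz: "coprime d z" using coprime_de unfolding e_eq by simp

lemma int_k_minus_1: "int (k - 1) = K - 1" using k_pos by simp

lemma K_cong_1: "[K = 1] (mod int z)"
proof -
  have "int z dvd int (k - 1)" using z_def by (simp only: int_dvd_int_iff) simp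
  then show ?thesis unfolding int_k_minus_1 by (simp add: cong_iff_dvd_diff)
qed

lemma coprime_K_minus_1_g: "coprime (K - 1) (int g)"
proof -
  have "coprime (k - 1) g"
  proof (rule coprimeI)
    fix c assume c: "c dvd k - 1" "c dvd g"
    then have "c dvd z" unfolding z_def by (metis dvd_mult2 e_eq gcd_greatest)
    then show "is_unit c" using c(2) coprime_gz coprime_common_divisor by blast
  qed
  then have "coprime (int (k - 1)) (int g)" by simp
  then show ?thesis unfolding int_k_minus_1 .
qed

text \<open>
  An even \<open>e\<close> makes \<open>k\<close> odd, so the factor \<open>2\<close> of \<open>e\<close> lies in \<open>z\<close>.
\<close>
lemma odd_g: "odd g"
proof
  assume "even g"
  then have "even e" using e_eq by simp
  then have "odd k" using coprime_ke by (auto elim: coprime_common_divisor)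
  then have "even z" using \<open>even e\<close> k_pos unfolding z_def by simp
  with \<open>even g\<close> coprime_gz show False by (auto elim: coprime_common_divisor)
qed

text \<open>
  Congruences modulo \<open>e\<close> are checked on the centre (modulo \<open>z\<close>, where \<open>k = 1\<close>) and on the commutator
  subgroup (modulo \<open>g\<close>, where \<open>k - 1\<close> is a unit).
\<close>
lemma cong_e_split: "[x = y] (mod int e) \<longleftrightarrow> [x = y] (mod int g) \<and> [x = y] (mod int z)"
  using coprime_gz unfolding e_eq
  by (auto intro: coprime_cong_mult cong_modulus_mult simp: mult.commute)

lemma K_power_cong: "[K ^ i = K ^ j] (mod int e) \<longleftrightarrow> [i = j] (mod d)"
  using order_divides_expdiff[of e k i j] coprime_ke ord_k
  by (simp add: coprime_commute flip: cong_int_iff[of "k ^ i" "k ^ j" e])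

lemma K_power_d: "[K ^ d = 1] (mod int e)"
  using K_power_cong[of d 0] by (simp add: cong_def)

text \<open>
  Used with \<open>a = 1 - k^j\<close>, to find the conjugation that moves an element \<open>\<tau>^j\<close> to
  \<open>\<sigma>^c \<tau>^j\<close>.
\<close>
lemma solve_cong_e:
  assumes "coprime a (int g)" and "int z dvd a" and "int z dvd c"
  shows "\<exists>m. [m * a = c] (mod int e)"
proof -
  obtain v where v: "[a * v = 1] (mod int g)" using cong_solve_coprime_int[OF assms(1)] by blast
  have "[c * v * a = c] (mod int g)"
    using cong_scalar_left[OF v, of c] by (simp add: ac_simps)
  moreover have "[c * v * a = c] (mod int z)" using assms by (simp add: cong_iff_dvd_diff)
  ultimately show ?thesis unfolding cong_e_split by blast
qed

definition el :: "int \<Rightarrow> nat \<Rightarrow> 'a" where "el i j = \<sigma> [^] i \<otimes> \<tau> [^] j"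

lemma el_closed [simp]: "el i j \<in> carrier G" by (simp add: el_def)

lemma el_0_0: "el 0 0 = \<one>" by (simp add: el_def)

lemma el_sigma: "el 1 0 = \<sigma>" and el_tau: "el 0 1 = \<tau>" by (simp_all add: el_def)

lemma tau_sigma: "\<tau> \<otimes> \<sigma> [^] (i::int) = \<sigma> [^] (K * i) \<otimes> \<tau>"
proof -
  have "inv \<tau> \<otimes> (\<tau> \<otimes> w) = w" if "w \<in> carrier G" for w
    using that by (simp add: m_assoc[symmetric])
  then have "group_hom G G (\<lambda>x. \<tau> \<otimes> x \<otimes> inv \<tau>)"
    by unfold_locales (auto simp: hom_def m_assoc)
  then have "\<tau> \<otimes> \<sigma> [^] i \<otimes> inv \<tau> = (\<sigma> [^] k) [^] i"
    using group_hom.hom_int_pow[of G G "\<lambda>x. \<tau> \<otimes> x \<otimes> inv \<tau>" \<sigma> i] conj by simp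
  also have "\<dots> = \<sigma> [^] (K * i)" by (simp add: int_pow_int[symmetric] int_pow_pow)
  finally show ?thesis by (metis inv_closed inv_solve_right' int_pow_closed m_closed sigma tau)
qed

lemma tau_pow_sigma: "\<tau> [^] j \<otimes> \<sigma> [^] (i::int) = \<sigma> [^] (K ^ j * i) \<otimes> \<tau> [^] (j::nat)"
proof (induction j)
  case (Suc j)
  have "\<tau> [^] Suc j \<otimes> \<sigma> [^] i = \<tau> \<otimes> (\<tau> [^] j \<otimes> \<sigma> [^] i)"
    by (subst nat_pow_Suc2) (simp_all add: m_assoc)
  also have "\<dots> = (\<tau> \<otimes> \<sigma> [^] (K ^ j * i)) \<otimes> \<tau> [^] j" by (simp add: Suc m_assoc)
  also have "\<dots> = \<sigma> [^] (K * (K ^ j * i)) \<otimes> (\<tau> \<otimes> \<tau> [^] j)" by (simp add: tau_sigma m_assoc)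
  also have "\<tau> \<otimes> \<tau> [^] j = \<tau> [^] Suc j" by (simp only: nat_pow_Suc2 tau)
  finally show ?case by (simp add: mult.assoc)
qed simp

lemma el_mult: "el i j \<otimes> el i' j' = el (i + K ^ j * i') (j + j')"
proof -
  have "el i j \<otimes> el i' j' = \<sigma> [^] i \<otimes> (\<tau> [^] j \<otimes> \<sigma> [^] i') \<otimes> \<tau> [^] j'"
    by (simp add: el_def m_assoc)
  also have "\<dots> = (\<sigma> [^] i \<otimes> \<sigma> [^] (K ^ j * i')) \<otimes> (\<tau> [^] j \<otimes> \<tau> [^] j')"
    by (simp add: tau_pow_sigma m_assoc)
  finally show ?thesis by (simp add: el_def int_pow_mult nat_pow_mult)
qed

lemma el_cong:
  assumes "[i = i'] (mod int e)" and "[j = j'] (mod d)" shows "el i j = el i' j'"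
proof -
  have s: "\<sigma> [^] i = \<sigma> [^] (i mod int e)" for i :: int
  proof -
    have "\<sigma> [^] i = (\<sigma> [^] int e) [^] (i div int e) \<otimes> \<sigma> [^] (i mod int e)"
      by (simp add: int_pow_pow int_pow_mult[symmetric])
    then show ?thesis by (simp add: int_pow_int sigma_pow)
  qed
  have t: "\<tau> [^] j = \<tau> [^] (j mod d)" for j :: nat
  proof -
    have "\<tau> [^] j = (\<tau> [^] d) [^] (j div d) \<otimes> \<tau> [^] (j mod d)"
      by (simp add: nat_pow_pow nat_pow_mult)
    then show ?thesis by (simp add: tau_pow)
  qed
  show ?thesis unfolding el_def using s t assms by (metis cong_def)
qed

lemma el_surj: "x \<in> carrier G \<Longrightarrow> \<exists>i j. x = el i j"
proof -
  assume "x \<in> carrier G"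
  then have "x \<in> generate G {\<sigma>, \<tau>}" using generated by blast
  then show ?thesis
  proof (induction rule: generate.induct)
    case one
    then show ?case using el_0_0 by metis
  next
    case (incl h)
    then show ?case using el_sigma el_tau by (metis insertE singletonD)
  next
    case (inv h)
    have "inv \<sigma> = el (- 1) 0" by (simp add: el_def int_pow_neg)
    moreover have "inv \<tau> = el 0 (d - 1)"
    proof (rule inv_equality)
      have "el 0 (d - 1) \<otimes> el 0 1 = \<one>"
        unfolding el_mult using d_pos by (simp add: el_def tau_pow)
      then show "el 0 (d - 1) \<otimes> \<tau> = \<one>" by (simp only: el_tau)
    qed auto
    ultimately show ?case using inv by (metis insertE singletonD)
  next
    case (eng h1 h2)
    then show ?case using el_mult by metis
  qed
qed

text \<open>
  The coordinates modulo \<open>e\<close> and \<open>d\<close> reach all of \<open>G\<close>, which has \<open>d e\<close> elements; so no two of them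
  coincide.
\<close>
lemma el_eq_iff: "el i j = el i' j' \<longleftrightarrow> [i = i'] (mod int e) \<and> [j = j'] (mod d)"
proof
  let ?S = "{0..<int e} \<times> {0..<d}"
  have red: "el i j = el (i mod int e) (j mod d)" "(i mod int e, j mod d) \<in> ?S" for i j
    using e_pos d_pos by (auto intro: el_cong)
  have "(\<lambda>(i, j). el i j) ` ?S = carrier G"
  proof (intro subset_antisym subsetI)
    fix x assume "x \<in> carrier G"
    then show "x \<in> (\<lambda>(i, j). el i j) ` ?S" using el_surj red by (metis (no_types, lifting) case_prod_conv image_eqI)
  qed auto
  then have "inj_on (\<lambda>(i, j). el i j) ?S"
    using order_eq by (intro eq_card_imp_inj_on) (auto simp: order_def)
  moreover assume "el i j = el i' j'"
  ultimately have "(i mod int e, j mod d) = (i' mod int e, j' mod d)"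
    using red by (metis (mono_tags, lifting) case_prod_conv inj_onD)
  then show "[i = i'] (mod int e) \<and> [j = j'] (mod d)" by (simp add: cong_def)
qed (auto intro: el_cong)

lemma finite_carrier: "finite (carrier G)"
  using order_eq d_pos e_pos order_gt_0_iff_finite by fastforce

text \<open>
  Modulo \<open>z\<close> the two coordinates do not interact, so there the first coordinate of a power is a multiple.
\<close>
lemma el_pow: "\<exists>s. el c t [^] (n::nat) = el s (t * n) \<and> [s = c * int n] (mod int z)"
proof (induction n)
  case 0
  show ?case using el_0_0 by (intro exI[of _ 0]) simp
next
  case (Suc n)
  then obtain s where s: "el c t [^] n = el s (t * n)" "[s = c * int n] (mod int z)" by blast
  have "el c t [^] Suc n = el (s + K ^ (t * n) * c) (t * Suc n)"
    by (simp add: s el_mult add.commute)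
  moreover have "[s + K ^ (t * n) * c = c * int n + 1 ^ (t * n) * c] (mod int z)"
    by (intro cong_add cong_mult cong_pow s K_cong_1) auto
  then have "[s + K ^ (t * n) * c = c * int (Suc n)] (mod int z)" by (simp add: algebra_simps)
  ultimately show ?case by blast
qed

lemma sigma_el_pow: "el i 0 [^] (n::nat) = el (i * int n) 0"
  by (simp add: el_def int_pow_pow flip: int_pow_int)

text \<open>
  The powers of \<open>\<sigma>\<close> are the solutions of \<open>x^e = 1\<close>, because \<open>d\<close> and \<open>e\<close> are coprime. Hence they
  form a characteristic subgroup.
\<close>
lemma pow_e_eq_one: "el i j [^] e = \<one> \<Longrightarrow> d dvd j"
proof -
  assume "el i j [^] e = \<one>"
  then obtain s where "el s (j * e) = el 0 0" using el_pow[of i j e] el_0_0 by metis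
  then have "d dvd j * e" using el_eq_iff by (simp add: cong_0_iff)
  then show ?thesis using coprime_de by (simp add: coprime_dvd_mult_left_iff)
qed

text \<open>
  Maps given by a formula in coordinates, which may be any integers. The choice is harmless when the
  formula depends only on the residues.
\<close>
definition coord_map :: "(int \<Rightarrow> nat \<Rightarrow> 'a) \<Rightarrow> 'a \<Rightarrow> 'a" where
  "coord_map F = (\<lambda>x\<in>carrier G. case SOME (i, j). x = el i j of (i, j) \<Rightarrow> F i j)"

lemma coord_map_el:
  assumes "\<And>i i' j j'. [i = i'] (mod int e) \<Longrightarrow> [j = j'] (mod d) \<Longrightarrow> F i j = F i' j'"
  shows "coord_map F (el i j) = F i j"
proof -
  obtain i' j' where ij: "(SOME (i', j'). el i j = el i' j') = (i', j')" by fastforce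
  have "case (i', j') of (i', j') \<Rightarrow> el i j = el i' j'"
    unfolding ij[symmetric] by (rule someI[of _ "(i, j)"]) simp
  then have "el i j = el i' j'" by simp
  then have "F i j = F i' j'" using assms[of i i' j j'] el_eq_iff[of i j i' j'] by simp
  then show ?thesis by (simp add: coord_map_def ij)
qed

lemma coord_ext:
  assumes "f \<in> extensional (carrier G)" "h \<in> extensional (carrier G)"
    and "\<And>i j. f (el i j) = h (el i j)"
  shows "f = h"
proof (rule extensionalityI[OF assms(1,2)])
  fix x assume "x \<in> carrier G"
  then obtain i j where "x = el i j" using el_surj by blast
  then show "f x = h x" using assms(3) by simp
qed

section \<open>Automorphisms\<close>

text \<open>
  For \<open>u = 1\<close> this is conjugation by \<open>\<sigma>^m\<close>, and for \<open>m = 0\<close> it multiplies the exponent of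
  \<open>\<sigma>\<close> by \<open>u\<close>.
\<close>
definition affine :: "int \<Rightarrow> int \<Rightarrow> 'a \<Rightarrow> 'a" where
  "affine u m = coord_map (\<lambda>i j. el (u * i + m * (1 - K ^ j)) j)"

lemma affine_el [simp]: "affine u m (el i j) = el (u * i + m * (1 - K ^ j)) j"
  unfolding affine_def
  by (rule coord_map_el, intro el_cong cong_add cong_mult cong_diff)
    (auto simp: K_power_cong)

lemma affine_extensional: "affine u m \<in> extensional (carrier G)"
  by (simp add: affine_def coord_map_def)

lemma affine_auto:
  assumes "coprime u (int e)" shows "affine u m \<in> auto G"
proof -
  obtain v where v: "[u * v = 1] (mod int e)" using cong_solve_coprime_int[OF assms] by blast
  have inverse: "affine u m (affine v (- v * m) x) = x" "affine v (- v * m) (affine u m x) = x"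
    if x: "x \<in> carrier G" for x
  proof -
    obtain i j where x: "x = el i j" using el_surj x by blast
    have "[u * v * i + (u * v) * (- m * (1 - K ^ j)) + m * (1 - K ^ j)
        = 1 * i + 1 * (- m * (1 - K ^ j)) + m * (1 - K ^ j)] (mod int e)"
      by (intro cong_add cong_mult v) auto
    then show "affine u m (affine v (- v * m) x) = x"
      unfolding x by (auto intro!: el_cong simp: algebra_simps)
    have "[u * v * i = 1 * i] (mod int e)" by (intro cong_mult v) auto
    then show "affine v (- v * m) (affine u m x) = x"
      unfolding x by (auto intro!: el_cong simp: algebra_simps)
  qed
  have closed: "affine u m x \<in> carrier G" if "x \<in> carrier G" for u m x
    using el_surj[OF that] by auto
  have "bij_betw (affine u m) (carrier G) (carrier G)"
    using inverse closed by (intro bij_betwI[where g = "affine v (- v * m)"]) auto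
  moreover have "affine u m \<in> hom G G"
  proof (rule homI)
    fix x y assume "x \<in> carrier G" "y \<in> carrier G"
    then obtain i j i' j' where xy: "x = el i j" "y = el i' j'" using el_surj by metis
    show "affine u m (x \<otimes> y) = affine u m x \<otimes> affine u m y"
      by (simp add: xy el_mult power_add algebra_simps)
  qed (rule closed)
  ultimately show ?thesis using affine_extensional by (simp add: auto_def Bij_def)
qed

lemma hom_el:
  assumes "group_hom G H \<beta>" shows "\<beta> (el i j) = \<beta> \<sigma> [^]\<^bsub>H\<^esub> i \<otimes>\<^bsub>H\<^esub> \<beta> \<tau> [^]\<^bsub>H\<^esub> j"
proof -
  interpret group_hom G H \<beta> by (rule assms)
  show ?thesis by (simp add: el_def hom_int_pow hom_nat_pow)
qed

lemma auto_eqI: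
  assumes "\<beta> \<in> auto G" "\<alpha> \<in> auto G" "\<beta> \<sigma> = \<alpha> \<sigma>" "\<beta> \<tau> = \<alpha> \<tau>" shows "\<beta> = \<alpha>"
proof (rule coord_ext)
  show "\<beta> (el i j) = \<alpha> (el i j)" for i j
    unfolding hom_el[OF auto_group_hom[OF assms(1)]] hom_el[OF auto_group_hom[OF assms(2)]] assms(3,4) ..
qed (use assms in \<open>auto simp: auto_def Bij_def\<close>)

lemma affine_sigma: "affine u m \<sigma> = el u 0" and affine_tau: "affine u m \<tau> = el (m * (1 - K)) 1"
  using affine_el[of u m 1 0] affine_el[of u m 0 1] by (simp_all add: el_sigma el_tau del: One_nat_def affine_el)

text \<open>
  An automorphism maps \<open>\<sigma>\<close> to a power of \<open>\<sigma>\<close>, and the relation between the generators forces the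
  image of \<open>\<tau>\<close> to be \<open>\<sigma>^c \<tau>\<close>, as \<open>\<tau>\<close> acts faithfully. The relation \<open>\<tau>^d = 1\<close> gives
  \<open>z dvd c\<close>, so this image is a conjugate of \<open>\<tau>\<close> under a power of \<open>\<sigma>\<close>.
\<close>
lemma auto_eq_affine:
  assumes \<beta>: "\<beta> \<in> auto G"
  obtains u m where "coprime u (int e)" "\<beta> = affine u m"
proof -
  interpret group_hom G G \<beta> using auto_group_hom[OF \<beta>] .
  obtain a b where ab: "\<beta> \<sigma> = el a b" using el_surj auto_closed[OF \<beta> sigma] by blast
  obtain c t where ct: "\<beta> \<tau> = el c t" using el_surj auto_closed[OF \<beta> tau] by blast
  have "el a b [^] e = \<one>" using hom_nat_pow[of \<sigma> e] ab sigma_pow by simp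
  then have "d dvd b" by (rule pow_e_eq_one)
  then have ab: "\<beta> \<sigma> = el a 0" unfolding ab by (intro el_cong) (auto simp: cong_0_iff)
  obtain x where x: "x \<in> carrier G" "\<beta> x = \<sigma>" using auto_surj[OF \<beta> sigma] by blast
  obtain i j where ij: "x = el i j" using el_surj x by blast
  have "\<beta> (x [^] e) = \<beta> \<one>" using x sigma_pow hom_nat_pow by simp
  then have "x [^] e = \<one>" using inj_onD[OF bij_betw_imp_inj_on[OF auto_bij[OF \<beta>]], of "x [^] e" \<one>] x(1) by simp
  then have "d dvd j" using pow_e_eq_one ij by blast
  then have "x = el i 0" unfolding ij by (intro el_cong) (auto simp: cong_0_iff)
  then have "x = \<sigma> [^] i" by (simp add: el_def)
  then have "\<sigma> = (\<sigma> [^] a) [^] i" using x(2) hom_int_pow[of \<sigma> i] ab by (simp add: el_def)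
  then have "el 1 0 = el (a * i) 0" by (simp add: el_def int_pow_pow)
  then have "[1 = a * i] (mod int e)" using el_eq_iff by blast
  then have "[a * i = 1] (mod int e)" by (rule cong_sym)
  then have cop: "coprime a (int e)" using coprime_iff_invertible_int by blast
  have "\<tau> \<otimes> \<sigma> = \<sigma> [^] k \<otimes> \<tau>" using tau_sigma[of 1] by (simp add: int_pow_int)
  then have "\<beta> (\<tau> \<otimes> \<sigma>) = \<beta> (\<sigma> [^] k \<otimes> \<tau>)" by simp
  then have "\<beta> \<tau> \<otimes> \<beta> \<sigma> = \<beta> (\<sigma> [^] k) \<otimes> \<beta> \<tau>" by simp
  then have "el (c + K ^ t * a) t = el (K * a + c) t"
    using hom_nat_pow[of \<sigma> k] ab ct by (simp add: el_mult sigma_el_pow mult.commute)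
  then have "[c + K ^ t * a = c + K * a] (mod int e)" by (simp add: el_eq_iff add.commute)
  then have "[K ^ t = K ^ 1] (mod int e)"
    using cop by (simp add: cong_add_lcancel cong_mult_rcancel)
  then have "[t = 1] (mod d)" unfolding K_power_cong .
  then have ct: "\<beta> \<tau> = el c 1" unfolding ct by (intro el_cong) auto
  obtain s where s: "el c 1 [^] d = el s (1 * d)" "[s = c * int d] (mod int z)" using el_pow by blast
  have "el c 1 [^] d = \<one>" using hom_nat_pow[of \<tau> d] ct tau_pow by simp
  then have "el s (1 * d) = el 0 0" using s el_0_0 by simp
  then have "[s = 0] (mod int z)" unfolding el_eq_iff cong_e_split by simp
  then have "int z dvd c * int d" using s(2) by (metis cong_0_iff cong_sym cong_trans)
  then have zc: "int z dvd c" using coprime_dz by (simp add: coprime_commute coprime_dvd_mult_left_iff)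
  have "coprime (1 - K) (int g)" using coprime_K_minus_1_g
    by (metis coprime_minus_left_iff minus_diff_eq)
  moreover have "int z dvd 1 - K" using K_cong_1 by (simp add: cong_iff_dvd_diff dvd_diff_commute)
  ultimately obtain m where m: "[m * (1 - K) = c] (mod int e)" using solve_cong_e zc by blast
  have "\<beta> = affine a m"
    using ab ct m by (intro auto_eqI \<beta> affine_auto cop) (auto simp: affine_sigma affine_tau intro: el_cong cong_sym)
  then show thesis using that cop by blast
qed

section \<open>Twists\<close>
definition twist :: "int \<Rightarrow> nat \<Rightarrow> 'a \<Rightarrow> 'a" where
  "twist \<kappa> \<epsilon> = coord_map (\<lambda>i j. el (\<kappa> ^ j * i) (\<epsilon> * j))"

text \<open>
  The residue of \<open>\<kappa>\<close> modulo \<open>e\<close> and that of \<open>\<epsilon>\<close> modulo \<open>d\<close> are determined by the factors. With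
  such parameters the twist preserves products modulo \<open>f1\<close> and reverses them modulo \<open>f2\<close>.
\<close>
definition twist_params :: "nat \<Rightarrow> nat \<Rightarrow> int \<Rightarrow> nat \<Rightarrow> bool" where
  "twist_params f1 f2 \<kappa> \<epsilon> \<longleftrightarrow> g = f1 * f2 \<and> [\<kappa> = 1] (mod int z) \<and>
     [\<kappa> = 1] (mod int f1) \<and> [K ^ \<epsilon> = K] (mod int f1) \<and>
     [\<kappa> * K = 1] (mod int f2) \<and> [K ^ \<epsilon> * K = 1] (mod int f2)"

lemma coprime_factors: "g = f1 * f2 \<Longrightarrow> coprime f1 f2"
  using sqfree_g squarefree_mult_imp_coprime by blast

lemma cong_e_split_factors:
  assumes "g = f1 * f2"
  shows "[x = y] (mod int e) \<longleftrightarrow>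
    [x = y] (mod int f1) \<and> [x = y] (mod int f2) \<and> [x = y] (mod int z)"
proof -
  have "coprime (int f1) (int f2)" using coprime_factors[OF assms] by simp
  then show ?thesis unfolding cong_e_split unfolding assms
    by (auto intro: coprime_cong_mult cong_modulus_mult simp: mult.commute)
qed

lemma K_power_cong_1: "[K ^ j = 1] (mod int z)"
  using cong_pow[OF K_cong_1, of j] by simp

text \<open>
  Modulo \<open>f2\<close> both \<open>\<kappa>\<close> and \<open>k^\<epsilon>\<close> are inverse to \<open>k\<close>, hence equal. The other statements
  follow from this one separately modulo \<open>f1\<close>, \<open>f2\<close> and \<open>z\<close>.
\<close>
lemma twist_params_cong:
  assumes "twist_params f1 f2 \<kappa> \<epsilon>"
  shows "[\<kappa> = K ^ \<epsilon>] (mod int f2)" and "[\<kappa> ^ \<epsilon> = K] (mod int f2)"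
    and "[\<kappa> ^ d = 1] (mod int e)" and "[\<kappa> ^ \<epsilon> * \<kappa> = 1] (mod int e)" and "[\<epsilon> * \<epsilon> = 1] (mod d)"
    and "coprime \<kappa> (int e)"
proof -
  have g: "g = f1 * f2" and z: "[\<kappa> = 1] (mod int z)" and f1: "[\<kappa> = 1] (mod int f1)"
    and E1: "[K ^ \<epsilon> = K] (mod int f1)" and f2: "[\<kappa> * K = 1] (mod int f2)"
    and E2: "[K ^ \<epsilon> * K = 1] (mod int f2)"
    using assms unfolding twist_params_def by auto
  note split = cong_e_split_factors[OF g]
  have "[\<kappa> * 1 = \<kappa> * (K ^ \<epsilon> * K)] (mod int f2)" by (intro cong_mult cong_sym[OF E2]) auto
  also have "\<kappa> * (K ^ \<epsilon> * K) = K ^ \<epsilon> * (\<kappa> * K)" by simp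
  also have "[\<dots> = K ^ \<epsilon> * 1] (mod int f2)" by (intro cong_mult f2) auto
  finally show \<kappa>: "[\<kappa> = K ^ \<epsilon>] (mod int f2)" by simp
  have \<kappa>K: "[\<kappa> ^ n * K ^ n = 1] (mod int f2)" for n
    using cong_pow[OF f2, of n] by (simp add: power_mult_distrib)
  have "[\<kappa> ^ \<epsilon> * \<kappa> = \<kappa> ^ \<epsilon> * K ^ \<epsilon>] (mod int f2)" by (intro cong_mult \<kappa>) auto
  then have inv2: "[\<kappa> ^ \<epsilon> * \<kappa> = 1] (mod int f2)" using \<kappa>K cong_trans by blast
  have "[\<kappa> ^ \<epsilon> * 1 = \<kappa> ^ \<epsilon> * (\<kappa> * K)] (mod int f2)" by (intro cong_mult cong_sym[OF f2]) auto
  also have "\<kappa> ^ \<epsilon> * (\<kappa> * K) = \<kappa> ^ \<epsilon> * \<kappa> * K" by simp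
  also have "[\<dots> = 1 * K] (mod int f2)" by (intro cong_mult inv2) auto
  finally show \<kappa>\<epsilon>: "[\<kappa> ^ \<epsilon> = K] (mod int f2)" by simp
  show "[\<kappa> ^ d = 1] (mod int e)" unfolding split
  proof (intro conjI)
    have "[K ^ d = 1] (mod int f2)" using K_power_d unfolding split by blast
    then have "[\<kappa> ^ d * 1 = \<kappa> ^ d * K ^ d] (mod int f2)" by (intro cong_mult) (auto intro: cong_sym)
    then show "[\<kappa> ^ d = 1] (mod int f2)" using \<kappa>K[of d] cong_trans by fastforce
  qed (use cong_pow[OF f1, of d] cong_pow[OF z, of d] in auto)
  show inv: "[\<kappa> ^ \<epsilon> * \<kappa> = 1] (mod int e)" unfolding split
  proof (intro conjI)
    show "[\<kappa> ^ \<epsilon> * \<kappa> = 1] (mod int f1)" "[\<kappa> ^ \<epsilon> * \<kappa> = 1] (mod int z)"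
      using cong_mult[OF cong_pow[OF f1] f1, of \<epsilon>] cong_mult[OF cong_pow[OF z] z, of \<epsilon>] by auto
  qed (rule inv2)
  then show "coprime \<kappa> (int e)"
    unfolding coprime_iff_invertible_int by (metis mult.commute)
  have "[K ^ (\<epsilon> * \<epsilon>) = K ^ 1] (mod int e)" unfolding split
  proof (intro conjI)
    show "[K ^ (\<epsilon> * \<epsilon>) = K ^ 1] (mod int f1)"
      using cong_trans[OF cong_pow[OF E1, of \<epsilon>] E1] by (simp add: power_mult)
    show "[K ^ (\<epsilon> * \<epsilon>) = K ^ 1] (mod int f2)"
      using cong_trans[OF cong_sym[OF cong_pow[OF \<kappa>, of \<epsilon>]] \<kappa>\<epsilon>] by (simp add: power_mult)
    show "[K ^ (\<epsilon> * \<epsilon>) = K ^ 1] (mod int z)"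
      using cong_trans[OF K_power_cong_1 cong_sym[OF K_power_cong_1]] .
  qed
  then show "[\<epsilon> * \<epsilon> = 1] (mod d)" unfolding K_power_cong .
qed

lemma twist_el:
  assumes "[\<kappa> ^ d = 1] (mod int e)"
  shows "twist \<kappa> \<epsilon> (el i j) = el (\<kappa> ^ j * i) (\<epsilon> * j)"
  unfolding twist_def
  by (rule coord_map_el, intro el_cong cong_mult cong_power_exponent[OF assms]) auto

lemma twist_extensional: "twist \<kappa> \<epsilon> \<in> extensional (carrier G)"
  by (simp add: twist_def coord_map_def)

lemma twist_closed: "[\<kappa> ^ d = 1] (mod int e) \<Longrightarrow> x \<in> carrier G \<Longrightarrow> twist \<kappa> \<epsilon> x \<in> carrier G"
  using el_surj[of x] by (auto simp: twist_el)

lemma twist_involution: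
  assumes params: "twist_params f1 f2 \<kappa> \<epsilon>" and x: "x \<in> carrier G"
  shows "twist \<kappa> \<epsilon> (twist \<kappa> \<epsilon> x) = x"
proof -
  note cong = twist_params_cong[OF params]
  obtain i j where x: "x = el i j" using el_surj[OF x] by blast
  have "[(\<kappa> ^ \<epsilon> * \<kappa>) ^ j * i = 1 ^ j * i] (mod int e)" by (intro cong_mult cong_pow cong(4)) auto
  then have "[\<kappa> ^ (\<epsilon> * j) * (\<kappa> ^ j * i) = i] (mod int e)"
    by (simp add: power_mult power_mult_distrib mult.assoc)
  moreover have "[\<epsilon> * (\<epsilon> * j) = j] (mod d)"
    using cong_scalar_right[OF cong(5), of j] by (simp add: mult.assoc)
  ultimately show ?thesis unfolding x by (simp add: twist_el[OF cong(3)] el_cong)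
qed

lemma twist_Bij:
  assumes params: "twist_params f1 f2 \<kappa> \<epsilon>" shows "twist \<kappa> \<epsilon> \<in> Bij (carrier G)"
proof -
  have "bij_betw (twist \<kappa> \<epsilon>) (carrier G) (carrier G)"
    using twist_involution[OF params] twist_closed[OF twist_params_cong(3)[OF params]]
    by (intro bij_betwI[where g = "twist \<kappa> \<epsilon>"]) auto
  then show ?thesis using twist_extensional by (simp add: Bij_def)
qed

lemma idempotent_exists:
  assumes "g = f1 * f2"
  shows "\<exists>r. [r = 0] (mod int f1) \<and> [r = 1] (mod int f2)"
  using binary_chinese_remainder_int[of "int f1" "int f2" 0 1] coprime_factors[OF assms] by simp

text \<open>
  Conjugation by the twist changes the sign of \<open>m\<close> in \<open>affine u m\<close> modulo \<open>f2\<close>. A right translation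
  stays one modulo \<open>f1\<close>, but modulo \<open>f2\<close>, where products are reversed, it becomes a left translation,
  that is, a right translation followed by a conjugation. The idempotent \<open>r\<close> combines the two cases.
\<close>
lemma twist_in_NHol:
  assumes params: "twist_params f1 f2 \<kappa> \<epsilon>" shows "twist \<kappa> \<epsilon> \<in> NHol G"
proof (rule involution_in_NHol[OF twist_Bij[OF params] twist_involution[OF params]])
  have g: "g = f1 * f2" and z: "[\<kappa> = 1] (mod int z)" and f1: "[\<kappa> = 1] (mod int f1)"
    and E1: "[K ^ \<epsilon> = K] (mod int f1)" and f2: "[\<kappa> * K = 1] (mod int f2)"
    and E2: "[K ^ \<epsilon> * K = 1] (mod int f2)"
    using params unfolding twist_params_def by auto
  note cong = twist_params_cong[OF params]
  note split = cong_e_split_factors[OF g]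
  obtain r where r1: "[r = 0] (mod int f1)" and r2: "[r = 1] (mod int f2)"
    using idempotent_exists[OF g] by blast
  fix h assume "h \<in> Hol G"
  then obtain \<beta> s where \<beta>: "\<beta> \<in> auto G" and s: "s \<in> carrier G"
    and h: "\<And>x. x \<in> carrier G \<Longrightarrow> h x = \<beta> x \<otimes> s"
    using HolE by blast
  obtain u m where u: "coprime u (int e)" and \<beta>: "\<beta> = affine u m" using auto_eq_affine[OF \<beta>] .
  obtain p q where s: "s = el p q" using el_surj[OF s] by blast
  \<comment> \<open>The factor \<open>1 - 2 r\<close> is \<open>1\<close> modulo \<open>f1\<close> and \<open>- 1\<close> modulo \<open>f2\<close>; the second summand of \<open>m'\<close> is the
      conjugation by the first coordinate of the twisted \<open>s\<close>, present only modulo \<open>f2\<close>.\<close>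
  define u' where "u' = \<kappa> ^ q * u"
  define m' where "m' = \<kappa> ^ q * (m * (1 - 2 * r)) + r * (\<kappa> ^ q * p)"
  have u': "coprime u' (int e)" unfolding u'_def using cong(6) u by simp
  have main: "[\<kappa> ^ (\<epsilon> * j + q) * (u * (\<kappa> ^ j * i) + m * (1 - K ^ (\<epsilon> * j)) + K ^ (\<epsilon> * j) * p)
      = u' * i + m' * (1 - K ^ j) + K ^ j * (\<kappa> ^ q * p)] (mod int e)" for i j
    unfolding split
  proof (intro conjI)
    \<comment> \<open>\<open>?L\<close> and \<open>?R\<close> abstract the powers whose residues differ between the three moduli.\<close>
    let ?L = "\<lambda>A B C. A * \<kappa> ^ q * (u * (B * i) + m * (1 - C) + C * p)"
    let ?R = "\<lambda>r C. \<kappa> ^ q * u * i + (\<kappa> ^ q * (m * (1 - 2 * r)) + r * (\<kappa> ^ q * p)) * (1 - C) + C * (\<kappa> ^ q * p)"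
    have L: "\<kappa> ^ (\<epsilon> * j + q) * (u * (\<kappa> ^ j * i) + m * (1 - K ^ (\<epsilon> * j)) + K ^ (\<epsilon> * j) * p)
        = ?L ((\<kappa> ^ \<epsilon>) ^ j) (\<kappa> ^ j) ((K ^ \<epsilon>) ^ j)"
      by (simp add: power_add power_mult)
    have R: "u' * i + m' * (1 - K ^ j) + K ^ j * (\<kappa> ^ q * p) = ?R r (K ^ j)"
      unfolding u'_def m'_def by simp
    have "[?L ((\<kappa> ^ \<epsilon>) ^ j) (\<kappa> ^ j) ((K ^ \<epsilon>) ^ j) = ?L ((1 ^ \<epsilon>) ^ j) (1 ^ j) (K ^ j)] (mod int f1)"
      by (intro cong_mult cong_add cong_diff cong_pow f1 E1 cong_refl)
    also have "?L ((1 ^ \<epsilon>) ^ j) (1 ^ j) (K ^ j) = ?R 0 (K ^ j)" by (simp add: algebra_simps)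
    also have "[\<dots> = ?R r (K ^ j)] (mod int f1)"
      by (intro cong_mult cong_add cong_diff cong_sym[OF r1] cong_refl)
    finally show "[\<kappa> ^ (\<epsilon> * j + q) * (u * (\<kappa> ^ j * i) + m * (1 - K ^ (\<epsilon> * j)) + K ^ (\<epsilon> * j) * p)
        = u' * i + m' * (1 - K ^ j) + K ^ j * (\<kappa> ^ q * p)] (mod int f1)" unfolding L R .
    have "[?L ((\<kappa> ^ \<epsilon>) ^ j) (\<kappa> ^ j) ((K ^ \<epsilon>) ^ j) = ?L ((1 ^ \<epsilon>) ^ j) (1 ^ j) ((1 ^ \<epsilon>) ^ j)] (mod int z)"
      by (intro cong_mult cong_add cong_diff cong_pow z K_cong_1 cong_refl)
    also have "?L ((1 ^ \<epsilon>) ^ j) (1 ^ j) ((1 ^ \<epsilon>) ^ j) = ?R r (1 ^ j)" by (simp add: algebra_simps)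
    also have "[\<dots> = ?R r (K ^ j)] (mod int z)"
      by (intro cong_mult cong_add cong_diff cong_pow cong_sym[OF K_cong_1] cong_refl)
    finally show "[\<kappa> ^ (\<epsilon> * j + q) * (u * (\<kappa> ^ j * i) + m * (1 - K ^ (\<epsilon> * j)) + K ^ (\<epsilon> * j) * p)
        = u' * i + m' * (1 - K ^ j) + K ^ j * (\<kappa> ^ q * p)] (mod int z)" unfolding L R .
    have "[?L ((\<kappa> ^ \<epsilon>) ^ j) (\<kappa> ^ j) ((K ^ \<epsilon>) ^ j) = ?L (K ^ j) (\<kappa> ^ j) (\<kappa> ^ j)] (mod int f2)"
      by (intro cong_mult cong_add cong_diff cong_pow cong(2) cong_sym[OF cong(1)] cong_refl)
    also have "?L (K ^ j) (\<kappa> ^ j) (\<kappa> ^ j)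
        = (\<kappa> * K) ^ j * (\<kappa> ^ q * (u * i - m + p)) + K ^ j * \<kappa> ^ q * m"
      by (simp add: algebra_simps power_mult_distrib)
    also have "[\<dots> = 1 ^ j * (\<kappa> ^ q * (u * i - m + p)) + K ^ j * \<kappa> ^ q * m] (mod int f2)"
      by (intro cong_mult cong_add cong_pow f2 cong_refl)
    also have "1 ^ j * (\<kappa> ^ q * (u * i - m + p)) + K ^ j * \<kappa> ^ q * m = ?R 1 (K ^ j)"
      by (simp add: algebra_simps)
    also have "[\<dots> = ?R r (K ^ j)] (mod int f2)"
      by (intro cong_mult cong_add cong_diff cong_sym[OF r2] cong_refl)
    finally show "[\<kappa> ^ (\<epsilon> * j + q) * (u * (\<kappa> ^ j * i) + m * (1 - K ^ (\<epsilon> * j)) + K ^ (\<epsilon> * j) * p)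
        = u' * i + m' * (1 - K ^ j) + K ^ j * (\<kappa> ^ q * p)] (mod int f2)" unfolding L R .
  qed
  let ?t = "twist \<kappa> \<epsilon>"
  show "compose (carrier G) ?t (compose (carrier G) h ?t) \<in> Hol G"
  proof (rule HolI[OF affine_auto[OF u', of m'], of "el (\<kappa> ^ q * p) (\<epsilon> * q)"])
    fix x assume "x \<in> carrier G"
    then obtain i j where x: "x = el i j" using el_surj by blast
    have "[\<epsilon> * \<epsilon> * j + \<epsilon> * q = 1 * j + \<epsilon> * q] (mod d)"
      by (intro cong_add cong_mult cong(5) cong_refl)
    then have "[\<epsilon> * (\<epsilon> * j + q) = j + \<epsilon> * q] (mod d)" by (simp add: algebra_simps)
    then show "compose (carrier G) ?t (compose (carrier G) h ?t) x
        = affine u' m' x \<otimes> el (\<kappa> ^ q * p) (\<epsilon> * q)"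
      unfolding x using main[of j i]
      by (simp add: compose_def h twist_el[OF cong(3)] \<beta> s el_mult el_cong)
  qed auto
qed auto

lemma twist_params_unique:
  assumes p: "twist_params f1 f2 \<kappa> \<epsilon>" and p': "twist_params f1 f2 \<kappa>' \<epsilon>'"
  shows "twist \<kappa>' \<epsilon>' = twist \<kappa> \<epsilon>"
proof (rule coord_ext[OF twist_extensional twist_extensional])
  have g: "g = f1 * f2" using p unfolding twist_params_def by blast
  note split = cong_e_split_factors[OF g]
  have "[\<kappa>' * 1 = \<kappa>' * (\<kappa> * K)] (mod int f2)" using p unfolding twist_params_def
    by (intro cong_mult) (auto intro: cong_sym)
  also have "\<kappa>' * (\<kappa> * K) = \<kappa> * (\<kappa>' * K)" by simp
  also have "[\<dots> = \<kappa> * 1] (mod int f2)" using p' unfolding twist_params_def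
    by (intro cong_mult) auto
  finally have "[\<kappa>' = \<kappa>] (mod int f2)" by simp
  moreover have "[\<kappa>' = \<kappa>] (mod int f1)" "[\<kappa>' = \<kappa>] (mod int z)"
    using p p' unfolding twist_params_def by (meson cong_sym cong_trans)+
  ultimately have \<kappa>: "[\<kappa>' = \<kappa>] (mod int e)" unfolding split by blast
  have "[K ^ \<epsilon>' = K ^ \<epsilon>] (mod int f2)"
    using twist_params_cong(1)[OF p] twist_params_cong(1)[OF p'] \<open>[\<kappa>' = \<kappa>] (mod int f2)\<close>
    by (meson cong_sym cong_trans)
  moreover have "[K ^ \<epsilon>' = K ^ \<epsilon>] (mod int f1)"
    using p p' unfolding twist_params_def by (meson cong_sym cong_trans)
  moreover have "[K ^ \<epsilon>' = K ^ \<epsilon>] (mod int z)"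
    using K_power_cong_1 by (meson cong_sym cong_trans)
  ultimately have \<epsilon>: "[\<epsilon>' = \<epsilon>] (mod d)" unfolding K_power_cong[symmetric] split by blast
  show "twist \<kappa>' \<epsilon>' (el i j) = twist \<kappa> \<epsilon> (el i j)" for i j
    unfolding twist_el[OF twist_params_cong(3)[OF p]] twist_el[OF twist_params_cong(3)[OF p']]
    by (intro el_cong cong_mult cong_pow \<kappa> \<epsilon> cong_refl)
qed

text \<open>
  The values at \<open>\<sigma>\<close> and \<open>\<tau>\<close> show that \<open>\<beta>\<close> fixes \<open>\<sigma>\<close> and the image of \<open>\<tau>\<close>; the value at
  \<open>\<sigma> \<tau>\<close> then gives the multiplier.
\<close>
lemma twist_coset_determines_multiplier:
  assumes p: "twist_params f1 f2 \<kappa> \<epsilon>" and p': "twist_params f1' f2' \<kappa>' \<epsilon>'"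
    and \<beta>: "\<beta> \<in> auto G" and eq: "\<And>x. x \<in> carrier G \<Longrightarrow> twist \<kappa>' \<epsilon>' x = \<beta> (twist \<kappa> \<epsilon> x)"
  shows "[\<kappa>' = \<kappa>] (mod int e)"
proof -
  obtain u m where \<beta>: "\<beta> = affine u m" using auto_eq_affine[OF \<beta>] .
  note t = twist_el[OF twist_params_cong(3)[OF p]] twist_el[OF twist_params_cong(3)[OF p']]
  have u: "[1 = u] (mod int e)" using eq[of "el 1 0"] by (simp add: t \<beta> el_eq_iff)
  have m: "[0 = m * (1 - K ^ \<epsilon>)] (mod int e)" using eq[of "el 0 1"] by (simp add: t \<beta> el_eq_iff)
  have "[\<kappa>' = u * \<kappa> + m * (1 - K ^ \<epsilon>)] (mod int e)"
    using eq[of "el 1 1"] by (simp add: t \<beta> el_eq_iff)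
  also have "[u * \<kappa> + m * (1 - K ^ \<epsilon>) = 1 * \<kappa> + 0] (mod int e)"
    by (intro cong_add cong_mult cong_sym[OF u] cong_sym[OF m] cong_refl)
  finally show ?thesis by simp
qed

text \<open>
  A common factor of \<open>f1'\<close> and \<open>f2\<close> would be a modulus in which \<open>\<kappa>\<close> is both \<open>1\<close> and
  \<open>k^(-1)\<close>, whereas \<open>k - 1\<close> is a unit modulo \<open>g\<close>.
\<close>
lemma twist_factor_dvd:
  assumes p: "twist_params f1 f2 \<kappa> \<epsilon>" and p': "twist_params f1' f2' \<kappa>' \<epsilon>'"
    and \<kappa>: "[\<kappa>' = \<kappa>] (mod int e)"
  shows "f1' dvd f1"
proof -
  have g: "g = f1 * f2" and g': "g = f1' * f2'" using p p' unfolding twist_params_def by auto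
  have "coprime f1' f2"
  proof (rule coprimeI)
    fix c assume c: "c dvd f1'" "c dvd f2"
    then have cg: "c dvd g" unfolding g by simp
    then have "int c dvd int e" unfolding e_eq by simp
    then have "[\<kappa>' = \<kappa>] (mod int c)" using \<kappa> cong_dvd_modulus by blast
    moreover have "[\<kappa>' = 1] (mod int c)" "[\<kappa> * K = 1] (mod int c)"
      using p p' c unfolding twist_params_def by (meson cong_dvd_modulus int_dvd_int_iff)+
    ultimately have "[1 = \<kappa>] (mod int c)" "[\<kappa> * K = 1] (mod int c)"
      by (auto intro: cong_trans cong_sym)
    then have "[1 * K = 1] (mod int c)" by (blast intro: cong_trans cong_scalar_right)
    then have "[K = 1] (mod int c)" by simp
    then have "int c dvd K - 1" by (simp add: cong_iff_dvd_diff)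
    then have "is_unit (int c)" using coprime_K_minus_1_g cg coprime_common_divisor
      by (metis int_dvd_int_iff)
    then show "is_unit c" by simp
  qed
  moreover have "f1' dvd f1 * f2" using g g' by (metis dvd_triv_left)
  ultimately show ?thesis by (simp add: coprime_dvd_mult_left_iff)
qed

section \<open>Classification of the normalizer\<close>

text \<open>
  Automorphisms do not change the exponent of \<open>\<tau>\<close>. So the exponent of \<open>\<tau>\<close> in \<open>\<pi> x\<close> is additive in
  \<open>x\<close> and vanishes modulo \<open>d\<close> on the powers of \<open>\<sigma>\<close>, whose order is coprime to \<open>d\<close>.
\<close>
lemma NHol_sigma_image:
  assumes \<pi>: "\<pi> \<in> NHol G" and one: "\<pi> \<one> = \<one>"
    and coc: "normalizer_cocycle \<pi> \<gamma>"
  shows "\<exists>j. \<pi> (el i 0) = el j 0" and "\<exists>j. \<pi> (el j 0) = el i 0"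
proof -
  note \<gamma> = normalizer_cocycleD(1)[OF coc] and op = normalizer_cocycleD(2)[OF coc]
    and equivariant = normalizer_cocycleD(3)[OF coc] and mult = normalizer_cocycleD(4)[OF coc]
  let ?S = "range (\<lambda>i. el i 0)"
  have bij: "bij_betw \<pi> (carrier G) (carrier G)"
    using subsetD[OF NHol_subset_Bij \<pi>] by (simp add: Bij_def)
  have S: "?S \<subseteq> carrier G" by auto
  obtain p q where pq: "\<pi> \<sigma> = el p q" using el_surj bij_betwE[OF bij] sigma by metis
  have power: "\<exists>s. \<pi> (el (int n) 0) = el s (n * q)" for n
  proof (induction n)
    case 0
    show ?case using one el_0_0 by (metis mult_0 of_nat_0)
  next
    case (Suc n)
    then obtain s where s: "\<pi> (el (int n) 0) = el s (n * q)" by blast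
    have "\<pi> \<sigma> \<in> carrier G" using bij_betwE[OF bij] by simp
    then obtain u m where um: "\<gamma> (\<pi> \<sigma>) = affine u m" using auto_eq_affine[OF \<gamma>] by metis
    have "el (int (Suc n)) 0 = el (int n) 0 \<otimes> \<sigma>"
      using el_mult[of "int n" 0 1 0] by (simp add: el_sigma add.commute)
    then show ?case
      using op[of "el (int n) 0" \<sigma>] by (auto simp: s um[unfolded pq] pq el_mult add.commute)
  qed
  obtain s where "\<pi> (el (int e) 0) = el s (e * q)" using power by blast
  moreover have "el (int e) 0 = \<one>" unfolding el_0_0[symmetric] by (intro el_cong) (auto simp: cong_0_iff)
  ultimately have "el s (e * q) = el 0 0" using one el_0_0 by simp
  then have "d dvd e * q" by (simp add: el_eq_iff cong_0_iff)
  then have q: "d dvd q" using coprime_de by (simp add: coprime_dvd_mult_right_iff)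
  have "\<pi> ` ?S \<subseteq> ?S"
  proof (intro image_subsetI, elim rangeE)
    fix x i assume "x = el i 0"
    moreover have "el i 0 = el (int (nat (i mod int e))) 0" using e_pos by (intro el_cong) auto
    ultimately obtain s where "\<pi> x = el s (nat (i mod int e) * q)" using power by metis
    also have "\<dots> = el s 0" using q by (intro el_cong) (auto simp: cong_0_iff)
    finally show "\<pi> x \<in> ?S" by blast
  qed
  moreover have "inj_on \<pi> ?S" using bij S by (meson bij_betw_imp_inj_on inj_on_subset)
  moreover have "finite ?S" using finite_subset[OF S finite_carrier] .
  ultimately have image: "\<pi> ` ?S = ?S" by (simp add: endo_inj_surj)
  have "\<pi> (el i 0) \<in> \<pi> ` ?S" by blast
  then show "\<exists>j. \<pi> (el i 0) = el j 0" unfolding image by blast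
  have "el i 0 \<in> ?S" by blast
  then have "el i 0 \<in> \<pi> ` ?S" unfolding image .
  then obtain j where "el i 0 = \<pi> (el j 0)" by blast
  then show "\<exists>j. \<pi> (el j 0) = el i 0" by metis
qed

text \<open>
  The powers of \<open>\<sigma>\<close> form a commutative subgroup also for the transported operation. If \<open>\<gamma> \<sigma>\<close> raises
  \<open>\<sigma>\<close> to the power \<open>u\<close>, then comparing \<open>\<sigma> \<circ> \<sigma>^2\<close> with \<open>\<sigma>^2 \<circ> \<sigma>\<close> gives
  \<open>(u - 1)^2 = 0\<close> modulo \<open>e\<close>, and \<open>e\<close> is squarefree.
\<close>
lemma cocycle_sigma:
  assumes \<pi>: "\<pi> \<in> NHol G" and one: "\<pi> \<one> = \<one>"
    and coc: "normalizer_cocycle \<pi> \<gamma>"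
  obtains r where "\<gamma> \<sigma> = affine 1 r"
proof -
  note \<gamma> = normalizer_cocycleD(1)[OF coc] and op = normalizer_cocycleD(2)[OF coc]
    and equivariant = normalizer_cocycleD(3)[OF coc] and mult = normalizer_cocycleD(4)[OF coc]
  obtain u m where um: "\<gamma> \<sigma> = affine u m" using auto_eq_affine[OF \<gamma>[OF sigma]] by metis
  note image = NHol_sigma_image(2)[OF \<pi> one coc]
  obtain i where i: "\<pi> (el i 0) = el 1 0" using image by blast
  obtain j where j: "\<pi> (el j 0) = el 2 0" using image by blast
  have g1: "\<gamma> (el 1 0) (el p 0) = el (u * p) 0" for p by (simp add: el_sigma um)
  have "\<gamma> (el 2 0) = \<gamma> (el 1 0 \<otimes> el 1 0)" by (simp add: el_mult)
  then have g2: "\<gamma> (el 2 0) (el p 0) = el (u * (u * p)) 0" for p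
    using mult[of "el 1 0" "el 1 0" "el p 0"] by (simp add: g1)
  have "el i 0 \<otimes> el j 0 = el j 0 \<otimes> el i 0" by (simp add: el_mult add.commute)
  then have "el (u * (u * 1)) 0 \<otimes> el 2 0 = el (u * 2) 0 \<otimes> el 1 0"
    using op[of "el i 0" "el j 0"] op[of "el j 0" "el i 0"] by (simp only: i j g1 g2 el_closed)
  then have "[u * (u * 1) + 2 = u * 2 + 1] (mod int e)" by (simp add: el_mult el_eq_iff)
  then have "int e dvd (u - 1) * (u - 1)" by (simp add: cong_iff_dvd_diff algebra_simps)
  then have "e dvd nat \<bar>u - 1\<bar> * nat \<bar>u - 1\<bar>"
    unfolding nat_abs_mult_distrib[symmetric] dvd_nat_abs_iff .
  then have "e dvd nat \<bar>u - 1\<bar>" by (rule squarefree_dvd_square[OF sqfree_e])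
  then have "[u = 1] (mod int e)" by (simp add: cong_iff_dvd_diff nat_abs_dvd_iff dvd_nat_abs_iff)
  then have "affine u m (el i j) = affine 1 m (el i j)" for i j
    unfolding affine_el by (intro el_cong cong_add cong_mult cong_refl)
  then have "affine u m = affine 1 m" by (rule coord_ext[OF affine_extensional affine_extensional])
  then show thesis using that um by simp
qed

text \<open>
  Write \<open>\<gamma> \<tau>\<close> as \<open>affine a b\<close>. Equivariance under \<open>\<sigma> \<mapsto> \<sigma>^(-1), \<tau> \<mapsto> \<tau>\<close> shows that
  \<open>b\<close> vanishes modulo \<open>g\<close>, equivariance under conjugation by \<open>\<sigma>\<close> gives \<open>a = 1 + r (k - 1)\<close>,
  and multiplicativity on \<open>\<tau> \<sigma> = \<sigma>^k \<tau>\<close> gives \<open>r k = a r\<close>. Together these make \<open>r\<close> idempotent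
  modulo \<open>g\<close>.
\<close>
lemma normalizer_cocycle_form:
  assumes coc: "normalizer_cocycle \<pi> \<gamma>"
    and sigma_r: "\<gamma> \<sigma> = affine 1 r"
  obtains a f1 f2 where "g = f1 * f2" "[r = 0] (mod int f1)" "[r = 1] (mod int f2)"
    "[a = 1] (mod int f1)" "[a = K] (mod int f2)"
    "\<forall>i j p q. \<gamma> (el i j) (el p q) = el (a ^ j * p + r * i * (1 - K ^ q)) q"
proof -
  note \<gamma> = normalizer_cocycleD(1)[OF coc] and op = normalizer_cocycleD(2)[OF coc]
    and equivariant = normalizer_cocycleD(3)[OF coc] and mult = normalizer_cocycleD(4)[OF coc]
  have g1: "\<gamma> (el 0 0) v = v" if v: "v \<in> carrier G" for v
  proof -
    have "\<gamma> (\<one> \<otimes> \<one>) v = \<gamma> \<one> (\<gamma> \<one> v)" using v by (intro mult) auto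
    then have "\<gamma> \<one> (\<gamma> \<one> v) = \<gamma> \<one> v" by simp
    then show ?thesis
      using inj_onD[OF bij_betw_imp_inj_on[OF auto_bij[OF \<gamma>[OF one_closed]]], of "\<gamma> \<one> v" v]
        v auto_closed[OF \<gamma>[OF one_closed]] unfolding el_0_0 by simp
  qed
  have sigma_n: "\<gamma> (el (int n) 0) (el p q) = el (p + r * int n * (1 - K ^ q)) q" for n p q
  proof (induction n)
    case 0
    then show ?case by (simp add: g1)
  next
    case (Suc n)
    have "el (int (Suc n)) 0 = \<sigma> \<otimes> el (int n) 0"
      using el_mult[of 1 0 "int n" 0] by (simp add: el_sigma)
    then have "\<gamma> (el (int (Suc n)) 0) (el p q) = \<gamma> \<sigma> (\<gamma> (el (int n) 0) (el p q))"
      by (simp add: mult)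
    also have "\<dots> = el (p + r * int (Suc n) * (1 - K ^ q)) q"
      unfolding Suc sigma_r by (simp add: algebra_simps)
    finally show ?case .
  qed
  have sigma_i: "\<gamma> (el i 0) (el p q) = el (p + r * i * (1 - K ^ q)) q" for i p q
  proof -
    have i: "[int (nat (i mod int e)) = i] (mod int e)" using e_pos by simp
    have "\<gamma> (el i 0) (el p q) = \<gamma> (el (int (nat (i mod int e))) 0) (el p q)"
      using el_cong[OF i cong_refl, of 0] by simp
    also have "\<dots> = el (p + r * i * (1 - K ^ q)) q"
      unfolding sigma_n by (intro el_cong cong_add cong_mult i cong_refl)
    finally show ?thesis .
  qed
  obtain a b where ab: "\<gamma> \<tau> = affine a b" using auto_eq_affine[OF \<gamma>[OF tau]] by metis
  have K_z: "int z dvd 1 - K ^ q" for q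
    using K_power_cong_1[of q] by (simp add: cong_iff_dvd_diff dvd_diff_commute)
  have K_g: "coprime (1 - K) (int g)" using coprime_K_minus_1_g
    by (metis coprime_minus_left_iff minus_diff_eq)
  have b: "int g dvd b"
  proof -
    have "affine (- 1) 0 \<in> auto G" by (intro affine_auto) simp
    then have "\<gamma> (affine (- 1) 0 \<tau>) (affine (- 1) 0 \<tau>) = affine (- 1) 0 (\<gamma> \<tau> \<tau>)"
      by (intro equivariant) auto
    then have "el (b * (1 - K)) 1 = el (- (b * (1 - K))) 1"
      by (simp add: affine_tau ab el_tau[unfolded One_nat_def])
    then have "[b * (1 - K) = - (b * (1 - K))] (mod int e)" unfolding el_eq_iff by blast
    then have "int g dvd (2 * b) * (1 - K)" unfolding cong_e_split
      by (simp add: cong_iff_dvd_diff algebra_simps)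
    then have "int g dvd 2 * b" using K_g by (simp add: coprime_commute coprime_dvd_mult_left_iff)
    moreover have "coprime (int g) 2" using odd_g by simp
    ultimately show ?thesis by (simp add: coprime_dvd_mult_right_iff)
  qed
  have tau_1: "\<gamma> \<tau> (el p q) = el (a * p) q" for p q
  proof -
    have "int e dvd b * (1 - K ^ q)" unfolding e_eq using b K_z mult_dvd_mono by auto
    then show ?thesis unfolding ab affine_el by (intro el_cong) (auto simp: cong_iff_dvd_diff)
  qed
  have tau_j: "\<gamma> (el 0 j) (el p q) = el (a ^ j * p) q" for j p q
  proof (induction j)
    case 0
    then show ?case by (simp add: g1)
  next
    case (Suc j)
    have "el 0 (Suc j) = \<tau> \<otimes> el 0 j"
      using el_mult[of 0 1 0 j] by (simp add: el_tau[unfolded One_nat_def])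
    then show ?case using mult[of \<tau> "el 0 j" "el p q"] by (simp add: Suc tau_1 mult.assoc)
  qed
  have form: "\<gamma> (el i j) (el p q) = el (a ^ j * p + r * i * (1 - K ^ q)) q" for i j p q
  proof -
    have "el i j = el i 0 \<otimes> el 0 j" by (simp add: el_mult)
    then show ?thesis using mult[of "el i 0" "el 0 j" "el p q"] by (simp add: tau_j sigma_i)
  qed
  have cancel: "[x = y] (mod int g)" if "[x * (1 - K) = y * (1 - K)] (mod int e)" for x y
    using that K_g unfolding cong_e_split by (simp add: cong_mult_rcancel)
  \<comment> \<open>\<open>affine 1 1\<close> is conjugation by \<open>\<sigma>\<close>.\<close>
  have ar: "[a + r * (1 - K) = 1] (mod int g)"
  proof (rule cancel)
    have "affine 1 1 \<in> auto G" by (intro affine_auto) simp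
    then have "\<gamma> (affine 1 1 (el 0 1)) (affine 1 1 (el 0 1)) = affine 1 1 (\<gamma> (el 0 1) (el 0 1))"
      by (intro equivariant) auto
    then have "el (a * (1 - K) + r * (1 - K) * (1 - K)) 1 = el (1 - K) 1"
      by (simp add: form)
    then show "[(a + r * (1 - K)) * (1 - K) = 1 * (1 - K)] (mod int e)"
      by (simp add: el_eq_iff distrib_right)
  qed
  have "[r * K = a * r] (mod int g)"
  proof (rule cancel)
    have "el 0 1 \<otimes> el 1 0 = el K 1" by (simp add: el_mult)
    then have "\<gamma> (el K 1) (el 0 1) = \<gamma> (el 0 1) (\<gamma> (el 1 0) (el 0 1))"
      using mult[of "el 0 1" "el 1 0" "el 0 1"] by simp
    then have "el (r * K * (1 - K)) 1 = el (a * (r * (1 - K))) 1" by (simp add: form)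
    then show "[r * K * (1 - K) = a * r * (1 - K)] (mod int e)"
      by (simp add: el_eq_iff mult.assoc)
  qed
  then have "[r * K + r * (r * (1 - K)) = a * r + r * (r * (1 - K))] (mod int g)"
    by (rule cong_add) simp
  also have "a * r + r * (r * (1 - K)) = r * (a + r * (1 - K))" by (simp add: algebra_simps)
  also have "[\<dots> = r * 1] (mod int g)" by (intro cong_mult ar cong_refl)
  finally have "int g dvd (r * (r - 1)) * (1 - K)" by (simp add: cong_iff_dvd_diff algebra_simps)
  then have "int g dvd r * (r - 1)" using K_g by (simp add: coprime_commute coprime_dvd_mult_left_iff)
  then have "g dvd nat \<bar>r\<bar> * nat \<bar>r - 1\<bar>" by (simp flip: nat_abs_mult_distrib)
  then obtain f1 f2 where g: "g = f1 * f2" and "f1 dvd nat \<bar>r\<bar>" "f2 dvd nat \<bar>r - 1\<bar>"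
    using division_decomp by blast
  then have r: "[r = 0] (mod int f1)" "[r = 1] (mod int f2)" by (simp_all add: cong_iff_dvd_diff)
  have ar1: "[a + r * (1 - K) = 1] (mod int f1)" and ar2: "[a + r * (1 - K) = 1] (mod int f2)"
    using ar unfolding g by (auto intro: cong_modulus_mult simp: mult.commute)
  have "[a + 0 * (1 - K) = a + r * (1 - K)] (mod int f1)"
    by (intro cong_add cong_mult cong_sym[OF r(1)] cong_refl)
  then have a1: "[a = 1] (mod int f1)" using ar1 by (auto intro: cong_trans)
  have "[a + 1 * (1 - K) = a + r * (1 - K)] (mod int f2)"
    by (intro cong_add cong_mult cong_sym[OF r(2)] cong_refl)
  then have "[a + 1 * (1 - K) = 1] (mod int f2)" using ar2 by (rule cong_trans)
  then have a2: "[a = K] (mod int f2)" by (simp add: cong_iff_dvd_diff)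
  show thesis by (rule that[OF g r a1 a2]) (intro allI form)
qed

lemma coprime_1_minus_K_power:
  assumes "g = f1 * f2" "[K ^ \<epsilon> = K] (mod int f1)" "[K ^ \<epsilon> * K = 1] (mod int f2)"
  shows "coprime (1 - K ^ \<epsilon>) (int g)"
proof -
  have K: "coprime (1 - K) (int f1)" "coprime (1 - K) (int f2)"
    using coprime_K_minus_1_g unfolding assms(1)
    by (metis coprime_minus_left_iff coprime_mult_right_iff minus_diff_eq of_nat_mult)+
  have "[1 - K = 1 - K ^ \<epsilon>] (mod int f1)" by (intro cong_diff cong_sym[OF assms(2)] cong_refl)
  then have "coprime (1 - K ^ \<epsilon>) (int f1)" using cong_imp_coprime K(1) by blast
  moreover have "[1 - K = - K * (1 - K ^ \<epsilon>)] (mod int f2)"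
    using assms(3) by (simp add: cong_iff_dvd_diff algebra_simps) (simp add: dvd_diff_commute)
  then have "coprime (- K * (1 - K ^ \<epsilon>)) (int f2)" using cong_imp_coprime K(2) by blast
  then have "coprime (1 - K ^ \<epsilon>) (int f2)" by simp
  ultimately show ?thesis unfolding assms(1) by simp
qed

text \<open>
  Let \<open>\<pi> \<sigma> = \<sigma>^i0\<close> and \<open>\<pi> \<tau> = \<sigma>^i1 \<tau>^\<epsilon>\<close>. Applying \<open>\<pi>\<close> to
  \<open>\<tau> \<sigma> = \<sigma>^k \<tau>\<close> gives \<open>r (1 - k^\<epsilon>) + k^\<epsilon> = a^\<epsilon> k\<close> modulo \<open>e\<close>, which is the
  condition on \<open>\<epsilon>\<close> modulo \<open>f1\<close> and \<open>f2\<close>, and modulo \<open>z\<close> it says that the central part is not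
  twisted. The twist with \<open>\<kappa> = a^\<epsilon>\<close> and \<open>\<pi>\<close> are isomorphisms to the same group, so an
  automorphism that matches them on the generators matches them everywhere.
\<close>
theorem NHol_fix_one_eq_affine_twist:
  assumes \<pi>: "\<pi> \<in> NHol G" and one: "\<pi> \<one> = \<one>"
  obtains f1 f2 \<kappa> \<epsilon> \<beta> where "twist_params f1 f2 \<kappa> \<epsilon>" "\<beta> \<in> auto G"
    "\<And>x. x \<in> carrier G \<Longrightarrow> \<pi> x = \<beta> (twist \<kappa> \<epsilon> x)"
proof -
  have bij: "bij_betw \<pi> (carrier G) (carrier G)"
    using subsetD[OF NHol_subset_Bij \<pi>] by (simp add: Bij_def)
  have cl: "\<pi> x \<in> carrier G" if "x \<in> carrier G" for x using bij_betwE[OF bij] that by blast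
  obtain \<gamma> where coc: "normalizer_cocycle \<pi> \<gamma>" using NHol_cocycle[OF \<pi> one] by blast
  note \<gamma> = normalizer_cocycleD(1)[OF coc] and op = normalizer_cocycleD(2)[OF coc]
    and equivariant = normalizer_cocycleD(3)[OF coc] and mult = normalizer_cocycleD(4)[OF coc]
  obtain r where r: "\<gamma> \<sigma> = affine 1 r" using cocycle_sigma[OF \<pi> one coc] .
  obtain a f1 f2 where g: "g = f1 * f2" and r1: "[r = 0] (mod int f1)" and r2: "[r = 1] (mod int f2)"
    and a1: "[a = 1] (mod int f1)" and a2: "[a = K] (mod int f2)"
    and form: "\<forall>i j p q. \<gamma> (el i j) (el p q) = el (a ^ j * p + r * i * (1 - K ^ q)) q"
    using normalizer_cocycle_form[OF coc r] .
  note split = cong_e_split_factors[OF g]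
  have circ: "\<pi> (w \<otimes> y) = el (a ^ j * p + r * i * (1 - K ^ q) + K ^ q * i) (q + j)"
    if "w \<in> carrier G" "y \<in> carrier G" "\<pi> w = el p q" "\<pi> y = el i j" for w y i j p q
    using op[OF that(1,2)] that(3,4) by (simp add: form el_mult)
  obtain i0 where i0: "\<pi> (el 1 0) = el i0 0"
    using NHol_sigma_image(1)[OF \<pi> one coc] by blast
  obtain i1 \<epsilon> where i1: "\<pi> (el 0 1) = el i1 \<epsilon>" using el_surj cl el_closed by metis
  have sigma_n: "\<pi> (el (int n) 0) = el (int n * i0) 0" for n
  proof (induction n)
    case 0
    then show ?case using one el_0_0 by simp
  next
    case (Suc n)
    have "el (int (Suc n)) 0 = el (int n) 0 \<otimes> el 1 0" by (simp add: el_mult add.commute)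
    then show ?case using circ[OF _ _ Suc i0] by (simp add: algebra_simps)
  qed
  have sigma_i: "\<pi> (el i 0) = el (i * i0) 0" for i
  proof -
    have i: "[int (nat (i mod int e)) = i] (mod int e)" using e_pos by simp
    have "\<pi> (el i 0) = \<pi> (el (int (nat (i mod int e))) 0)"
      using el_cong[OF i cong_refl, of 0] by simp
    also have "\<dots> = el (i * i0) 0" unfolding sigma_n by (intro el_cong cong_mult i cong_refl)
    finally show ?thesis .
  qed
  have i0_unit: "coprime i0 (int e)"
  proof -
    obtain i where "\<pi> (el i 0) = el 1 0" using NHol_sigma_image(2)[OF \<pi> one coc] by blast
    then have "[i * i0 = 1] (mod int e)" unfolding sigma_i el_eq_iff by blast
    then have "[i0 * i = 1] (mod int e)" by (simp add: mult.commute)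
    then show ?thesis unfolding coprime_iff_invertible_int by blast
  qed
  have "el 0 1 \<otimes> el 1 0 = el K 0 \<otimes> el 0 1" by (simp add: el_mult)
  then have "el (i1 + r * i0 * (1 - K ^ \<epsilon>) + K ^ \<epsilon> * i0) \<epsilon> = el (a ^ \<epsilon> * (K * i0) + i1) \<epsilon>"
    using circ[OF _ _ i1 i0] circ[OF _ _ sigma_i[of K] i1] by simp
  then have "[i1 + (r * (1 - K ^ \<epsilon>) + K ^ \<epsilon>) * i0 = i1 + (a ^ \<epsilon> * K) * i0] (mod int e)"
    by (simp add: el_eq_iff algebra_simps)
  then have rel: "[r * (1 - K ^ \<epsilon>) + K ^ \<epsilon> = a ^ \<epsilon> * K] (mod int e)"
    using i0_unit by (simp add: cong_add_lcancel cong_mult_rcancel)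
  have rel1: "[r * (1 - K ^ \<epsilon>) + K ^ \<epsilon> = a ^ \<epsilon> * K] (mod int f1)"
    and rel2: "[r * (1 - K ^ \<epsilon>) + K ^ \<epsilon> = a ^ \<epsilon> * K] (mod int f2)"
    and relz: "[r * (1 - K ^ \<epsilon>) + K ^ \<epsilon> = a ^ \<epsilon> * K] (mod int z)"
    using rel unfolding split by auto
  have E1: "[K ^ \<epsilon> = K] (mod int f1)"
  proof -
    have "[0 * (1 - K ^ \<epsilon>) + K ^ \<epsilon> = r * (1 - K ^ \<epsilon>) + K ^ \<epsilon>] (mod int f1)"
      by (intro cong_add cong_mult cong_sym[OF r1] cong_refl)
    also note rel1
    also have "[a ^ \<epsilon> * K = 1 ^ \<epsilon> * K] (mod int f1)" by (intro cong_mult cong_pow a1 cong_refl)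
    finally show ?thesis by simp
  qed
  have E2: "[K ^ \<epsilon> * K = 1] (mod int f2)"
  proof -
    have "[K ^ \<epsilon> * K = a ^ \<epsilon> * K] (mod int f2)"
      by (intro cong_mult cong_pow cong_sym[OF a2] cong_refl)
    also note cong_sym[OF rel2]
    also have "[r * (1 - K ^ \<epsilon>) + K ^ \<epsilon> = 1 * (1 - K ^ \<epsilon>) + K ^ \<epsilon>] (mod int f2)"
      by (intro cong_add cong_mult r2 cong_refl)
    finally show ?thesis by simp
  qed
  have \<epsilon>z: "[a ^ \<epsilon> = 1] (mod int z)"
  proof -
    have "[a ^ \<epsilon> * 1 = a ^ \<epsilon> * K] (mod int z)" by (intro cong_mult cong_sym[OF K_cong_1] cong_refl)
    also note cong_sym[OF relz]
    also have "[r * (1 - K ^ \<epsilon>) + K ^ \<epsilon> = r * (1 - 1) + 1] (mod int z)"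
      by (intro cong_add cong_mult cong_diff K_power_cong_1 cong_refl)
    finally show ?thesis by simp
  qed
  have tau_s: "\<exists>s. \<pi> (el 0 m) = el s (\<epsilon> * m) \<and> [s = int m * i1] (mod int z)" for m
  proof (induction m)
    case 0
    then show ?case using one el_0_0 by (intro exI[of _ 0]) simp
  next
    case (Suc m)
    then obtain s where s: "\<pi> (el 0 m) = el s (\<epsilon> * m)" "[s = int m * i1] (mod int z)" by blast
    have "el 0 (Suc m) = el 0 m \<otimes> el 0 1" by (simp add: el_mult)
    then have "\<pi> (el 0 (Suc m))
        = el (a ^ \<epsilon> * s + r * i1 * (1 - K ^ (\<epsilon> * m)) + K ^ (\<epsilon> * m) * i1) (\<epsilon> * Suc m)"
      using circ[OF _ _ s(1) i1] by (simp add: add.commute)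
    moreover have "[a ^ \<epsilon> * s + r * i1 * (1 - K ^ (\<epsilon> * m)) + K ^ (\<epsilon> * m) * i1
        = 1 * (int m * i1) + r * i1 * (1 - 1) + 1 * i1] (mod int z)"
      by (intro cong_add cong_mult cong_diff \<epsilon>z s(2) K_power_cong_1 cong_refl)
    then have "[a ^ \<epsilon> * s + r * i1 * (1 - K ^ (\<epsilon> * m)) + K ^ (\<epsilon> * m) * i1
        = int (Suc m) * i1] (mod int z)" by (simp add: algebra_simps)
    ultimately show ?case by blast
  qed
  have i1_z: "int z dvd i1"
  proof -
    obtain s where s: "\<pi> (el 0 d) = el s (\<epsilon> * d)" "[s = int d * i1] (mod int z)" using tau_s by blast
    have "el 0 d = \<one>" unfolding el_0_0[symmetric] by (intro el_cong) (auto simp: cong_0_iff)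
    then have "el s (\<epsilon> * d) = el 0 0" using s one el_0_0 by simp
    then have "[s = 0] (mod int z)" unfolding el_eq_iff cong_e_split by blast
    then have "int z dvd int d * i1" using s(2) by (metis cong_0_iff cong_sym cong_trans)
    then show ?thesis using coprime_dz by (simp add: coprime_commute coprime_dvd_mult_right_iff)
  qed
  define \<kappa> where "\<kappa> = a ^ \<epsilon>"
  have params: "twist_params f1 f2 \<kappa> \<epsilon>"
    unfolding twist_params_def
  proof (intro conjI g E1 E2)
    show "[\<kappa> = 1] (mod int z)" using \<epsilon>z unfolding \<kappa>_def .
    show "[\<kappa> = 1] (mod int f1)" using cong_pow[OF a1, of \<epsilon>] unfolding \<kappa>_def by simp
    have "[\<kappa> * K = K ^ \<epsilon> * K] (mod int f2)" unfolding \<kappa>_def by (intro cong_mult cong_pow a2 cong_refl)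
    then show "[\<kappa> * K = 1] (mod int f2)" using E2 by (rule cong_trans)
  qed
  have "int z dvd 1 - K ^ \<epsilon>"
    using K_power_cong_1[of \<epsilon>] by (simp add: cong_iff_dvd_diff dvd_diff_commute)
  then obtain m' where m': "[m' * (1 - K ^ \<epsilon>) = i1] (mod int e)"
    using solve_cong_e[OF coprime_1_minus_K_power[OF g E1 E2]] i1_z by blast
  have tau_m: "\<pi> (el 0 m) = el (m' * (1 - K ^ (\<epsilon> * m))) (\<epsilon> * m)" for m
  proof (induction m)
    case 0
    then show ?case using one el_0_0 by simp
  next
    case (Suc m)
    let ?P = "K ^ (\<epsilon> * m)" and ?Q = "K ^ \<epsilon>"
    let ?F = "\<lambda>A r i1. A * (m' * (1 - ?P)) + r * i1 * (1 - ?P) + ?P * i1"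
    have "el 0 (Suc m) = el 0 m \<otimes> el 0 1" by (simp add: el_mult)
    then have "\<pi> (el 0 (Suc m)) = el (?F (a ^ \<epsilon>) r i1) (\<epsilon> * Suc m)"
      using circ[OF _ _ Suc i1] by (simp add: add.commute)
    moreover have "[?F (a ^ \<epsilon>) r i1 = m' * (1 - ?P * ?Q)] (mod int e)"
      unfolding split
    proof (intro conjI)
      have m1: "[i1 = m' * (1 - ?Q)] (mod int f1)" and m2: "[i1 = m' * (1 - ?Q)] (mod int f2)"
        using cong_sym[OF m'] unfolding split by auto
      have "[?F (a ^ \<epsilon>) r i1 = ?F (1 ^ \<epsilon>) 0 (m' * (1 - ?Q))] (mod int f1)"
        by (intro cong_add cong_mult cong_pow a1 r1 m1 cong_refl)
      then show "[?F (a ^ \<epsilon>) r i1 = m' * (1 - ?P * ?Q)] (mod int f1)" by (simp add: algebra_simps)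
      have "[?F (a ^ \<epsilon>) r i1 = ?F ?Q 1 (m' * (1 - ?Q))] (mod int f2)"
        by (intro cong_add cong_mult cong_pow a2 r2 m2 cong_refl)
      then show "[?F (a ^ \<epsilon>) r i1 = m' * (1 - ?P * ?Q)] (mod int f2)" by (simp add: algebra_simps)
      have "[i1 = 0] (mod int z)" using i1_z by (simp add: cong_0_iff)
      then have "[?F (a ^ \<epsilon>) r i1 = a ^ \<epsilon> * (m' * (1 - 1)) + r * 0 * (1 - ?P) + ?P * 0] (mod int z)"
        by (intro cong_add cong_mult cong_diff K_power_cong_1 cong_refl)
      moreover have "[m' * (1 - 1 * 1) = m' * (1 - ?P * ?Q)] (mod int z)"
        by (intro cong_mult cong_diff cong_sym[OF K_power_cong_1] cong_refl)
      ultimately show "[?F (a ^ \<epsilon>) r i1 = m' * (1 - ?P * ?Q)] (mod int z)"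
        by (auto intro: cong_trans)
    qed
    moreover have "?P * ?Q = K ^ (\<epsilon> * Suc m)" by (simp add: power_add)
    ultimately show ?case by (simp add: el_cong)
  qed
  show thesis
  proof (rule that[OF params affine_auto[OF i0_unit, of m']])
    fix x assume "x \<in> carrier G"
    then obtain i m where x: "x = el i m" using el_surj by blast
    have "\<pi> (el i m) = \<pi> (el i 0 \<otimes> el 0 m)" by (simp add: el_mult)
    also have "\<dots> = el (i0 * (\<kappa> ^ m * i) + m' * (1 - K ^ (\<epsilon> * m))) (\<epsilon> * m)"
      using circ[OF _ _ sigma_i tau_m, of i m] by (simp add: \<kappa>_def power_mult algebra_simps)
    finally show "\<pi> x = affine i0 m' (twist \<kappa> \<epsilon> x)"
      by (simp add: x twist_el[OF twist_params_cong(3)[OF params]])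
  qed
qed

section \<open>Counting the cosets\<close>
lemma coprime_k_factor: "g = f1 * f2 \<Longrightarrow> coprime f1 k \<and> coprime f2 k"
  using coprime_ke unfolding e_eq by (auto simp: coprime_commute)

lemma twist_params_imp_factor_pair:
  assumes "twist_params f1 f2 \<kappa> \<epsilon>" shows "(f1, f2) \<in> factor_pairs g k"
proof -
  have g: "g = f1 * f2" and E1: "[K ^ \<epsilon> = K] (mod int f1)" and E2: "[K ^ \<epsilon> * K = 1] (mod int f2)"
    using assms unfolding twist_params_def by auto
  let ?c = "gcd (Pocklington.ord f1 k) (Pocklington.ord f2 k)"
  have "[k ^ \<epsilon> = k ^ 1] (mod f1)" using E1 by (simp flip: cong_int_iff)
  then have "[\<epsilon> = 1] (mod Pocklington.ord f1 k)"
    using order_divides_expdiff coprime_k_factor[OF g] by blast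
  then have "[int \<epsilon> = int 1] (mod int ?c)"
    unfolding cong_int_iff by (rule cong_dvd_modulus_nat) simp
  then have c1: "int ?c dvd int \<epsilon> - 1" by (simp add: cong_iff_dvd_diff)
  have "[k ^ (\<epsilon> + 1) = 1] (mod f2)" using E2 by (simp add: mult.commute flip: cong_int_iff)
  then have "?c dvd \<epsilon> + 1" unfolding ord_divides by (rule dvd_trans[OF gcd_dvd2])
  then have "int ?c dvd int (\<epsilon> + 1)" unfolding int_dvd_int_iff .
  then have "int ?c dvd int (\<epsilon> + 1) - (int \<epsilon> - 1)" using c1 by (rule dvd_diff)
  then have "int ?c dvd int 2" by simp
  then have "?c \<le> 2" unfolding int_dvd_int_iff by (rule dvd_imp_le) simp
  then show ?thesis using g g_pos unfolding factor_pairs_def by simp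
qed

text \<open>
  Write \<open>2\<close> as an integer combination of the two orders. Then \<open>E\<close>, reduced to a natural number
  \<open>\<epsilon>\<close>, is \<open>1\<close> minus the first summand and \<open>- 1\<close> plus the second.
\<close>
lemma factor_pair_imp_twist_params:
  assumes "(f1, f2) \<in> factor_pairs g k" shows "\<exists>\<kappa> \<epsilon>. twist_params f1 f2 \<kappa> \<epsilon>"
proof -
  define o1 where "o1 = Pocklington.ord f1 k"
  define o2 where "o2 = Pocklington.ord f2 k"
  have g: "g = f1 * f2" and gcd_le: "gcd o1 o2 \<le> 2"
    using assms unfolding factor_pairs_def o1_def o2_def by auto
  have cop: "coprime f1 k" "coprime f2 k" using coprime_k_factor[OF g] by auto
  have pos: "o1 > 0" "o2 > 0" using cop unfolding o1_def o2_def by simp_all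
  have "gcd o1 o2 > 0" using pos by simp
  then have "gcd o1 o2 = 1 \<or> gcd o1 o2 = 2" using gcd_le by linarith
  then have "int (gcd o1 o2) dvd 2" by auto
  then obtain c where c: "2 = int (gcd o1 o2) * c" by (rule dvdE)
  obtain x y where "x * int o1 + y * int o2 = gcd (int o1) (int o2)" using bezout_int by blast
  then have "int o1 * (x * c) + int o2 * (y * c) = 2" using c by (simp add: algebra_simps) (metis distrib_left mult.commute mult.left_commute)
  then have "1 - int o1 * (x * c) = int o2 * (y * c) - 1" by simp
  define E where "E = 1 - int o1 * (x * c)"
  define \<epsilon> where "\<epsilon> = nat (E mod (int o1 * int o2))"
  have "int \<epsilon> = E mod (int o1 * int o2)" unfolding \<epsilon>_def using pos by simp
  then have "[int \<epsilon> = E] (mod (int o1 * int o2))" by simp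
  then have \<epsilon>: "[int \<epsilon> = E] (mod int o1)" "[int \<epsilon> = E] (mod int o2)"
    by (auto intro: cong_modulus_mult simp: mult.commute)
  have "[E = int 1] (mod int o1)" unfolding E_def by (simp add: cong_iff_dvd_diff)
  then have "[\<epsilon> = 1] (mod o1)" using \<epsilon>(1) cong_trans cong_int_iff by blast
  then have "[k ^ \<epsilon> = k ^ 1] (mod f1)" using order_divides_expdiff cop unfolding o1_def by blast
  then have E1: "[K ^ \<epsilon> = K] (mod int f1)" by (simp flip: cong_int_iff)
  have "E + 1 = int o2 * (y * c)" unfolding E_def using \<open>1 - _ = _\<close> by simp
  then have "[E + 1 = 0] (mod int o2)" by (simp add: cong_0_iff)
  moreover have "[int \<epsilon> + 1 = E + 1] (mod int o2)" by (intro cong_add \<epsilon> cong_refl)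
  ultimately have "[int \<epsilon> + 1 = 0] (mod int o2)" by (blast intro: cong_trans)
  then have "int o2 dvd int (\<epsilon> + 1)" by (simp add: cong_0_iff add.commute)
  then have "[k ^ (\<epsilon> + 1) = 1] (mod f2)" unfolding ord_divides o2_def[symmetric] int_dvd_int_iff .
  then have E2: "[K ^ \<epsilon> * K = 1] (mod int f2)" by (simp add: mult.commute flip: cong_int_iff)
  have "coprime K (int f2)" using cop by (simp add: coprime_commute)
  then obtain v where v: "[K * v = 1] (mod int f2)" using cong_solve_coprime_int by blast
  have "coprime (int f1 * int z) (int f2)"
    using coprime_factors[OF g] coprime_gz unfolding g by (simp add: coprime_commute)
  then obtain \<kappa> where \<kappa>: "[\<kappa> = 1] (mod (int f1 * int z))" "[\<kappa> = v] (mod int f2)"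
    using binary_chinese_remainder_int by blast
  have "[\<kappa> * K = v * K] (mod int f2)" by (intro cong_mult \<kappa> cong_refl)
  then have "[\<kappa> * K = 1] (mod int f2)" using v by (simp add: mult.commute) (rule cong_trans)
  moreover have "[\<kappa> = 1] (mod int f1)" "[\<kappa> = 1] (mod int z)"
    using \<kappa>(1) by (auto intro: cong_modulus_mult simp: mult.commute)
  ultimately show ?thesis using g E1 E2 unfolding twist_params_def by blast
qed

text \<open>
  By \<open>twist_params_unique\<close> the value does not depend on the chosen parameters.
\<close>
definition factor_twist :: "nat \<times> nat \<Rightarrow> 'a \<Rightarrow> 'a" where
  "factor_twist f = (case SOME (\<kappa>, \<epsilon>). twist_params (fst f) (snd f) \<kappa> \<epsilon> of (\<kappa>, \<epsilon>) \<Rightarrow> twist \<kappa> \<epsilon>)"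

lemma factor_twist_eq:
  assumes "twist_params f1 f2 \<kappa> \<epsilon>" shows "factor_twist (f1, f2) = twist \<kappa> \<epsilon>"
proof -
  obtain \<kappa>' \<epsilon>' where *: "(SOME (\<kappa>, \<epsilon>). twist_params f1 f2 \<kappa> \<epsilon>) = (\<kappa>', \<epsilon>')" by fastforce
  have "case (\<kappa>', \<epsilon>') of (\<kappa>, \<epsilon>) \<Rightarrow> twist_params f1 f2 \<kappa> \<epsilon>"
    unfolding *[symmetric] by (rule someI[of _ "(\<kappa>, \<epsilon>)"]) (simp add: assms)
  then have "twist_params f1 f2 \<kappa>' \<epsilon>'" by simp
  then have "twist \<kappa>' \<epsilon>' = twist \<kappa> \<epsilon>" using twist_params_unique assms by blast
  then show ?thesis by (simp add: factor_twist_def *)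
qed

lemma factor_pair_twist:
  assumes "f \<in> factor_pairs g k"
  obtains \<kappa> \<epsilon> where "twist_params (fst f) (snd f) \<kappa> \<epsilon>" "factor_twist f = twist \<kappa> \<epsilon>"
proof -
  obtain \<kappa> \<epsilon> where "twist_params (fst f) (snd f) \<kappa> \<epsilon>"
    using factor_pair_imp_twist_params[of "fst f" "snd f"] assms by auto
  then show thesis using that factor_twist_eq by (metis prod.collapse)
qed

lemma finite_factor_pairs: "finite (factor_pairs g k)"
proof -
  have "factor_pairs g k \<subseteq> {f. f dvd g} \<times> {f. f dvd g}" unfolding factor_pairs_def by auto
  moreover have "finite {f. f dvd g}" using g_pos by (rule finite_divisors_nat)
  ultimately show ?thesis by (meson finite_SigmaI finite_subset)
qed

lemma NHol_in_twist_coset: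
  assumes \<pi>: "\<pi> \<in> NHol G"
  obtains f h where "f \<in> factor_pairs g k" "h \<in> Hol G" "\<pi> = compose (carrier G) h (factor_twist f)"
proof -
  have \<pi>_bij: "\<pi> \<in> Bij (carrier G)" using \<pi> NHol_subset_Bij by blast
  define s where "s = \<pi> \<one>"
  have s: "s \<in> carrier G" unfolding s_def using Bij_imp_funcset[OF \<pi>_bij] by (rule funcset_mem) simp
  define \<pi>' where "\<pi>' = compose (carrier G) (\<lambda>x\<in>carrier G. x \<otimes> inv s) \<pi>"
  interpret P: group "Perm G" by (rule group_BijGroup)
  have sub: "subgroup (NHol G) (Perm G)" unfolding NHol_def
    by (intro P.normalizer_imp_subgroup subgroup.subset[OF subgroup_Hol])
  have tr: "(\<lambda>x\<in>carrier G. x \<otimes> inv s) \<in> NHol G"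
  proof -
    have "Hol G \<subseteq> NHol G" using normal_imp_subgroup[OF P.subgroup_in_normalizer[OF subgroup_Hol]]
      subgroup.subset unfolding NHol_def by fastforce
    then show ?thesis using translation_in_Hol[of "inv s"] s by blast
  qed
  have "\<pi>' \<in> NHol G"
    using subgroup.m_closed[OF sub tr \<pi>] \<pi>_bij translation_Bij[of "inv s"] s
    unfolding \<pi>'_def by (simp add: BijGroup_def)
  moreover have "\<pi>' \<one> = \<one>" unfolding \<pi>'_def using s by (simp add: compose_def s_def[symmetric])
  ultimately obtain f1 f2 \<kappa> \<epsilon> \<beta> where params: "twist_params f1 f2 \<kappa> \<epsilon>" and \<beta>: "\<beta> \<in> auto G"
    and eq: "\<And>x. x \<in> carrier G \<Longrightarrow> \<pi>' x = \<beta> (twist \<kappa> \<epsilon> x)"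
    using NHol_fix_one_eq_affine_twist by metis
  define h where "h = (\<lambda>x\<in>carrier G. \<beta> x \<otimes> s)"
  have h: "h \<in> Hol G" unfolding h_def by (rule HolI[OF \<beta> s]) auto
  have "\<pi> x = h (twist \<kappa> \<epsilon> x)" if x: "x \<in> carrier G" for x
  proof -
    have \<pi>x: "\<pi> x \<in> carrier G" using Bij_imp_funcset[OF \<pi>_bij] x by (rule funcset_mem)
    have "\<pi> x \<otimes> inv s = \<beta> (twist \<kappa> \<epsilon> x)" using eq[OF x] x \<pi>x by (simp add: \<pi>'_def compose_def)
    then have "\<pi> x = \<beta> (twist \<kappa> \<epsilon> x) \<otimes> s" using \<pi>x s by (metis inv_closed inv_solve_right' m_closed)
    then show ?thesis using twist_closed[OF twist_params_cong(3)[OF params] x] by (simp add: h_def)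
  qed
  then have "\<pi> = compose (carrier G) h (twist \<kappa> \<epsilon>)"
    using \<pi>_bij by (auto simp: compose_def Bij_def extensional_def fun_eq_iff)
  then show thesis
    using that h twist_params_imp_factor_pair[OF params] factor_twist_eq[OF params] by metis
qed

lemma factor_twist_coset_inj:
  assumes f: "f \<in> factor_pairs g k" and f': "f' \<in> factor_pairs g k" and h: "h \<in> Hol G"
    and eq: "factor_twist f' = compose (carrier G) h (factor_twist f)"
  shows "f' = f"
proof -
  obtain \<kappa> \<epsilon> where p: "twist_params (fst f) (snd f) \<kappa> \<epsilon>" "factor_twist f = twist \<kappa> \<epsilon>"
    using factor_pair_twist[OF f] .
  obtain \<kappa>' \<epsilon>' where p': "twist_params (fst f') (snd f') \<kappa>' \<epsilon>'" "factor_twist f' = twist \<kappa>' \<epsilon>'"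
    using factor_pair_twist[OF f'] .
  have pt: "twist \<kappa>' \<epsilon>' x = h (twist \<kappa> \<epsilon> x)" if "x \<in> carrier G" for x
    using eq that unfolding p p' by (simp add: compose_def)
  have one: "twist \<kappa> \<epsilon> \<one> = \<one>" "twist \<kappa>' \<epsilon>' \<one> = \<one>"
    using twist_el[OF twist_params_cong(3)[OF p(1)], of _ 0 0]
      twist_el[OF twist_params_cong(3)[OF p'(1)], of _ 0 0] by (simp_all add: el_0_0)
  have "h \<one> = \<one>" using pt[of \<one>] one by simp
  then have "h \<in> auto G" using Hol_fix_one h by blast
  then have \<kappa>: "[\<kappa>' = \<kappa>] (mod int e)" using twist_coset_determines_multiplier[OF p(1) p'(1)] pt by blast
  have "fst f' = fst f"
    using twist_factor_dvd[OF p(1) p'(1) \<kappa>] twist_factor_dvd[OF p'(1) p(1) cong_sym[OF \<kappa>]]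
    by (rule dvd_antisym)
  moreover have "fst f * snd f = fst f' * snd f'" using p(1) p'(1) unfolding twist_params_def by simp
  moreover have "fst f > 0" using f unfolding factor_pairs_def by auto
  ultimately show ?thesis by (simp add: prod_eq_iff)
qed

theorem T_group_elementary:
  "elementary_2_abelian (T_group G) \<and> order (T_group G) = card (factor_pairs g k)"
proof -
  interpret P: group "Perm G" by (rule group_BijGroup)
  let ?N = "Perm G\<lparr>carrier := NHol G\<rparr>"
  have normal: "Hol G \<lhd> ?N" unfolding NHol_def by (rule P.subgroup_in_normalizer[OF subgroup_Hol])
  then have N: "group ?N" by (simp add: normal_def)
  have tw: "factor_twist f \<in> NHol G" "factor_twist f \<in> Bij (carrier G)"
    and invol: "factor_twist f \<otimes>\<^bsub>Perm G\<^esub> factor_twist f = \<one>\<^bsub>Perm G\<^esub>" if f: "f \<in> factor_pairs g k" for f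
  proof -
    obtain \<kappa> \<epsilon> where p: "twist_params (fst f) (snd f) \<kappa> \<epsilon>" "factor_twist f = twist \<kappa> \<epsilon>"
      using factor_pair_twist[OF f] .
    show "factor_twist f \<in> NHol G" "factor_twist f \<in> Bij (carrier G)"
      unfolding p(2) using twist_in_NHol[OF p(1)] twist_Bij[OF p(1)] .
    show "factor_twist f \<otimes>\<^bsub>Perm G\<^esub> factor_twist f = \<one>\<^bsub>Perm G\<^esub>"
      unfolding p(2) using twist_Bij[OF p(1)] twist_involution[OF p(1)]
      by (simp add: BijGroup_def compose_def fun_eq_iff)
  qed
  have coset: "\<pi> \<in> Hol G #>\<^bsub>?N\<^esub> factor_twist f \<longleftrightarrow>
      (\<exists>h\<in>Hol G. \<pi> = compose (carrier G) h (factor_twist f))" if f: "f \<in> factor_pairs g k" for \<pi> f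
    using tw(2)[OF f] Hol_subset_Bij unfolding r_coset_def by (auto simp: BijGroup_def subset_iff)
  show ?thesis unfolding T_group_def
  proof (rule group.elementary_2_abelian_Mod[OF N normal finite_factor_pairs])
    show "factor_twist f \<in> carrier ?N" if "f \<in> factor_pairs g k" for f using tw(1)[OF that] by simp
    show "factor_twist f \<otimes>\<^bsub>?N\<^esub> factor_twist f = \<one>\<^bsub>?N\<^esub>" if "f \<in> factor_pairs g k" for f
      using invol[OF that] by simp
    show "\<exists>f\<in>factor_pairs g k. \<pi> \<in> Hol G #>\<^bsub>?N\<^esub> factor_twist f" if "\<pi> \<in> carrier ?N" for \<pi>
    proof -
      have "\<pi> \<in> NHol G" using that by simp
      then obtain f h where "f \<in> factor_pairs g k" "h \<in> Hol G"
        "\<pi> = compose (carrier G) h (factor_twist f)" by (rule NHol_in_twist_coset)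
      then show ?thesis using coset by blast
    qed
    show "f' = f" if "f \<in> factor_pairs g k" "f' \<in> factor_pairs g k"
      "factor_twist f' \<in> Hol G #>\<^bsub>?N\<^esub> factor_twist f" for f f'
      using factor_twist_coset_inj that coset by blast
  qed
qed

end

section \<open>From the presentation to the relations\<close>
lemma (in group) word_eval_in_generate:
  assumes "range gen \<subseteq> carrier G" shows "word_eval G gen w \<in> generate G (range gen)"
proof (induction w)
  case Nil
  show ?case by (simp add: word_eval_def generate.one)
next
  case (Cons l w)
  obtain x b where l: "l = (x, b)" by (cases l)
  have "(if b then gen x else inv (gen x)) \<in> generate G (range gen)"
    by (auto intro: generate.incl generate.inv)
  then show ?case using Cons generate.eng unfolding word_eval_def l by fastforce
qed

lemma (in group) word_eval_replicate:
  "gen x \<in> carrier G \<Longrightarrow> word_eval G gen (replicate n (x, True)) = gen x [^] n"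
proof (induction n)
  case (Suc n)
  then show ?case using nat_pow_Suc2[of "gen x" n] by (simp add: word_eval_def)
qed (simp add: word_eval_def)

lemma presented_by_relation:
  "presented_by G gen R \<Longrightarrow> (l, r) \<in> R \<Longrightarrow> word_eval G gen l = word_eval G gen r"
  using word_cong.relation[of l r R "[]" "[]"] unfolding presented_by_def by simp

theorem theorem2p1:
  fixes G :: "('a, 'b) monoid_scheme" and \<sigma> \<tau> :: 'a and d e k z g :: nat
  assumes "group G" and "finite (carrier G)"
    and "d > 0" and "e > 0" and "k > 0"
    and "presented_by G (case_gen2 \<sigma> \<tau>) (metacyclic_relations e d k)"
    and "coprime k e"
    and "ord e k = d"
    and "order G = d * e" and "squarefree (order G)"
    and "z = gcd e (k - 1)" and "g = e div z"
  shows "elementary_2_abelian (T_group G) \<and> order (T_group G) = card (factor_pairs g k)"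
proof -
  interpret group G by fact
  let ?gen = "case_gen2 \<sigma> \<tau>"
  have gen: "range ?gen \<subseteq> carrier G" "range (word_eval G ?gen) = carrier G"
    using assms(6) unfolding presented_by_def by auto
  have "UNIV = {Sigma_gen, Tau_gen}" using gen2.exhaust by auto
  then have "range ?gen = ?gen ` {Sigma_gen, Tau_gen}" by (rule arg_cong)
  then have range: "range ?gen = {\<sigma>, \<tau>}" by simp
  then have mem: "\<sigma> \<in> carrier G" "\<tau> \<in> carrier G" using gen(1) by auto
  have generated: "carrier G \<subseteq> generate G {\<sigma>, \<tau>}"
    unfolding gen(2)[symmetric]
    by (intro image_subsetI word_eval_in_generate[OF gen(1), unfolded range])
  note rel = presented_by_relation[OF assms(6), unfolded metacyclic_relations_def]
  have "word_eval G ?gen (replicate e (Sigma_gen, True)) = word_eval G ?gen []" by (rule rel) simp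
  then have s: "\<sigma> [^]\<^bsub>G\<^esub> e = \<one>\<^bsub>G\<^esub>" using mem by (simp add: word_eval_replicate) (simp add: word_eval_def)
  have "word_eval G ?gen (replicate d (Tau_gen, True)) = word_eval G ?gen []" by (rule rel) simp
  then have t: "\<tau> [^]\<^bsub>G\<^esub> d = \<one>\<^bsub>G\<^esub>" using mem by (simp add: word_eval_replicate) (simp add: word_eval_def)
  have "word_eval G ?gen [(Tau_gen, True), (Sigma_gen, True), (Tau_gen, False)]
      = word_eval G ?gen (replicate k (Sigma_gen, True))" by (rule rel) simp
  then have c: "\<tau> \<otimes>\<^bsub>G\<^esub> \<sigma> \<otimes>\<^bsub>G\<^esub> inv\<^bsub>G\<^esub> \<tau> = \<sigma> [^]\<^bsub>G\<^esub> k"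
    using mem by (simp add: word_eval_replicate) (simp add: word_eval_def m_assoc)
  interpret faithful_metacyclic G \<sigma> \<tau> d e k z g
    using assms mem generated s t c by unfold_locales auto
  show ?thesis by (rule T_group_elementary)
qed

end
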